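(* Let $t=(t_1,t_2,\dots)$ be a sequence of indeterminates. For a partition $\lambda$ and any $r\ge\ell(\lambda)$ set \[ |\lambda\rangle_{[\mathbf t]}:=\psi_{\lambda_1-1}e^{H(t_1)}\psi_{\lambda_2-2}e^{H(t_2)}\cdots e^{H(t_{r-1})}\psi_{\lambda_r-r}e^{H(t_r)}|-r\rangle \] (this does not depend on $r\ge\ell(\lambda)$), and for a partition $\mu$ and an integer $r\ge\ell(\mu)$ set \[ {}_{[\mathbf t]}\langle\mu|:=\langle -r|e^{-H(t_r)}\psi^*_{\mu_r-r}e^{-H(t_{r-1})}\cdots e^{-H(t_2)}\psi^*_{\mu_2-2}e^{-H(t_1)}\psi^*_{\mu_1-1}. \] Then for all sufficiently large $r$ (with ${}_{[\mathbf t]}\langle\mu|$ formed with that $r$), ${}_{[\mathbf t]}\langle\mu|\lambda\rangle_{[\mathbf t]}=\delta_{\lambda,\mu}$ for all partitions $\lambda,\mu$.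
   Context: Let $k$ be a field of characteristic $0$ containing all indeterminates involved. Let $\mathcal A$ be the $k$-algebra generated by $\psi_n,\psi_n^*$ ($n\in\mathbb Z$) subject to $\psi_m\psi_n+\psi_n\psi_m=0$, $\psi_m^*\psi_n^*+\psi_n^*\psi_m^*=0$, $\psi_m\psi_n^*+\psi_n^*\psi_m=\delta_{m,n}$. The Fock space $\mathcal F$ is the left $\mathcal A$-module generated by $|0\rangle$ with $\psi_m|0\rangle=0$ ($m<0$), $\psi_n^*|0\rangle=0$ ($n\ge0$); $\mathcal F^*$ is the right $\mathcal A$-module generated by $\langle0|$ with $\langle0|\psi_n=0$ ($n\ge0$), $\langle0|\psi_m^*=0$ ($m<0$). There is a unique bilinear pairing $\langle w|v\rangle$ between $\mathcal F^*$ and $\mathcal F$ with $\langle0|0\rangle=1$ and $(\langle w|a)|v\rangle=\langle w|(a|v\rangle)$ for $a\in\mathcal A$. The anti-involution $*$ of $\mathcal A$ swaps $\psi_n\leftrightarrow\psi_n^*$; the transpose of $a|0\rangle$ is $\langle0|a^*$. Shifted vacua: $|m\rangle=\psi_{m-1}\cdots\psi_0|0\rangle$ ($m\ge0$), $|m\rangle=\psi^*_m\cdots\psi^*_{-1}|0\rangle$ ($m<0$), and $\langle m|$ is the transpose of $|m\rangle$. Heisenberg operators $a_m=\sum_{i\in\mathbb Z}:\psi_i\psi^*_{i+m}:$ with $:\psi_i\psi_j^*:=\psi_i\psi_j^*-\langle0|\psi_i\psi_j^*|0\rangle$. For a single indeterminate $t$, $H(t)=\sum_{n>0}\frac{t^n}{n}a_n$;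 the operators $e^{\pm H(t)}$ act on $\mathcal F$ from the left and on $\mathcal F^*$ from the right, with $e^{H(t)}\psi_ne^{-H(t)}=\sum_{i\ge0}t^i\psi_{n-i}$ and $e^{H(t)}\psi^*_ne^{-H(t)}=\psi^*_n-t\psi^*_{n+1}$. $\ell(\lambda)$ denotes the number of nonzero parts of a partition $\lambda$, and parts beyond $\ell(\lambda)$ are $0$. *)

theory Defs
  imports Complex_Main "HOL-Library.Poly_Mapping" "HOL-Library.Groups_Big_Fun"
begin

section \<open>The Clifford algebra\<close>

datatype fermion = Psi int | Psi_star int

datatype fermion_word = Word "fermion list"

text \<open>The free monoid on the generators, written additively: this is the convention under which
  the multiplication of \<^type>\<open>poly_mapping\<close> is the convolution product, so that
  \<open>fermion_word \<Rightarrow>\<^sub>0 'k\<close> is the free associative \<open>'k\<close>-algebra on the generators.\<close>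

instantiation fermion_word :: monoid_add
begin

definition zero_fermion_word :: fermion_word where "0 = Word []"

fun plus_fermion_word :: "fermion_word \<Rightarrow> fermion_word \<Rightarrow> fermion_word" where
  "Word u + Word v = Word (u @ v)"

instance
proof
  fix a b c :: fermion_word
  show "a + b + c = a + (b + c)" by (cases a; cases b; cases c) simp
  show "0 + a = a" by (cases a) (simp add: zero_fermion_word_def)
  show "a + 0 = a" by (cases a) (simp add: zero_fermion_word_def)
qed

end

definition free_scalar :: "'k::field \<Rightarrow> fermion_word \<Rightarrow>\<^sub>0 'k" where
  "free_scalar c = Poly_Mapping.single 0 c"

definition free_psi :: "int \<Rightarrow> fermion_word \<Rightarrow>\<^sub>0 'k::field" where
  "free_psi n = Poly_Mapping.single (Word [Psi n]) 1"

definition free_psi_star :: "int \<Rightarrow> fermion_word \<Rightarrow>\<^sub>0 'k::field" where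
  "free_psi_star n = Poly_Mapping.single (Word [Psi_star n]) 1"

definition clifford_relators :: "(fermion_word \<Rightarrow>\<^sub>0 'k::field) set" where
  "clifford_relators =
     {free_psi m * free_psi n + free_psi n * free_psi m | m n. True} \<union>
     {free_psi_star m * free_psi_star n + free_psi_star n * free_psi_star m | m n. True} \<union>
     {free_psi m * free_psi_star n + free_psi_star n * free_psi m
        - free_scalar (if m = n then 1 else 0) | m n. True}"

inductive_set two_sided_ideal :: "'a::{ring,monoid_mult} set \<Rightarrow> 'a set" for G where
  zero: "0 \<in> two_sided_ideal G"
| add: "x \<in> two_sided_ideal G \<Longrightarrow> y \<in> two_sided_ideal G \<Longrightarrow> x + y \<in> two_sided_ideal G"
| gen: "g \<in> G \<Longrightarrow> a * g * b \<in> two_sided_ideal G"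

inductive_set left_ideal :: "'a::{ring,monoid_mult} set \<Rightarrow> 'a set" for G where
  zero: "0 \<in> left_ideal G"
| add: "x \<in> left_ideal G \<Longrightarrow> y \<in> left_ideal G \<Longrightarrow> x + y \<in> left_ideal G"
| gen: "g \<in> G \<Longrightarrow> a * g \<in> left_ideal G"

inductive_set right_ideal :: "'a::{ring,monoid_mult} set \<Rightarrow> 'a set" for G where
  zero: "0 \<in> right_ideal G"
| add: "x \<in> right_ideal G \<Longrightarrow> y \<in> right_ideal G \<Longrightarrow> x + y \<in> right_ideal G"
| gen: "g \<in> G \<Longrightarrow> g * a \<in> right_ideal G"

lemma two_sided_ideal_mult:
  assumes "x \<in> two_sided_ideal G"
  shows "a * x * b \<in> two_sided_ideal G"
  using assms
proof induction
  case zero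
  show ?case by (simp add: two_sided_ideal.zero)
next
  case (add x y)
  then show ?case by (simp add: two_sided_ideal.add distrib_left distrib_right)
next
  case (gen g c d)
  then have "(a * c) * g * (d * b) \<in> two_sided_ideal G" by (rule two_sided_ideal.gen)
  then show ?case by (simp add: mult.assoc)
qed

lemma two_sided_ideal_mult_left: "x \<in> two_sided_ideal G \<Longrightarrow> a * x \<in> two_sided_ideal G"
  using two_sided_ideal_mult[of x G a 1] by simp

lemma two_sided_ideal_mult_right: "x \<in> two_sided_ideal G \<Longrightarrow> x * b \<in> two_sided_ideal G"
  using two_sided_ideal_mult[of x G 1 b] by simp

lemma two_sided_ideal_uminus: "x \<in> two_sided_ideal G \<Longrightarrow> - x \<in> two_sided_ideal G"
  using two_sided_ideal_mult_left[of x G "- 1"] by simp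

lemma left_ideal_mult: "x \<in> left_ideal G \<Longrightarrow> a * x \<in> left_ideal G"
proof (induction rule: left_ideal.induct)
  case (gen g c)
  then have "(a * c) * g \<in> left_ideal G" by (rule left_ideal.gen)
  then show ?case by (simp add: mult.assoc)
qed (auto simp: distrib_left intro: left_ideal.intros)

lemma left_ideal_uminus: "x \<in> left_ideal G \<Longrightarrow> - x \<in> left_ideal G"
  using left_ideal_mult[of x G "- 1"] by simp

lemma right_ideal_mult: "x \<in> right_ideal G \<Longrightarrow> x * a \<in> right_ideal G"
proof (induction rule: right_ideal.induct)
  case (gen g c)
  then have "g * (c * a) \<in> right_ideal G" by (rule right_ideal.gen)
  then show ?case by (simp add: mult.assoc)
qed (auto simp: distrib_right intro: right_ideal.intros)

lemma right_ideal_uminus: "x \<in> right_ideal G \<Longrightarrow> - x \<in> right_ideal G"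
  using right_ideal_mult[of x G "- 1"] by simp

lemma equivp_diff_mem:
  fixes I :: "'a::ab_group_add set"
  assumes z: "0 \<in> I" and a: "\<And>x y. x \<in> I \<Longrightarrow> y \<in> I \<Longrightarrow> x + y \<in> I" and n: "\<And>x. x \<in> I \<Longrightarrow> - x \<in> I"
  shows "equivp (\<lambda>a b. a - b \<in> I)"
proof (rule equivpI)
  show "reflp (\<lambda>a b. a - b \<in> I)" using z by (auto intro: reflpI)
  show "symp (\<lambda>a b. a - b \<in> I)"
    by (rule sympI) (metis n minus_diff_eq)
  show "transp (\<lambda>a b. a - b \<in> I)"
    by (rule transpI) (metis a diff_add_cancel add_diff_eq)
qed

definition clifford_eq :: "(fermion_word \<Rightarrow>\<^sub>0 'k::field) \<Rightarrow> (fermion_word \<Rightarrow>\<^sub>0 'k) \<Rightarrow> bool" where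
  "clifford_eq a b \<longleftrightarrow> a - b \<in> two_sided_ideal clifford_relators"

quotient_type (overloaded) 'k clifford = "fermion_word \<Rightarrow>\<^sub>0 'k::field" / clifford_eq
  unfolding clifford_eq_def[abs_def]
  by (intro equivp_diff_mem two_sided_ideal.zero two_sided_ideal.add two_sided_ideal_uminus)

text \<open>Only \<^class>\<open>ring\<close> and \<^class>\<open>monoid_mult\<close> are instantiated, since \<^class>\<open>ring_1\<close>
  would also require \<open>0 \<noteq> 1\<close>.\<close>

instantiation clifford :: (field) "{ring,monoid_mult}"
begin

lift_definition zero_clifford :: "'a clifford" is 0 .

lift_definition one_clifford :: "'a clifford" is 1 .

lift_definition plus_clifford :: "'a clifford \<Rightarrow> 'a clifford \<Rightarrow> 'a clifford" is "(+)"
  unfolding clifford_eq_def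
  by (metis add_diff_add two_sided_ideal.add)

lift_definition uminus_clifford :: "'a clifford \<Rightarrow> 'a clifford" is uminus
  unfolding clifford_eq_def
  by (metis minus_diff_minus two_sided_ideal_uminus)

lift_definition minus_clifford :: "'a clifford \<Rightarrow> 'a clifford \<Rightarrow> 'a clifford" is "(-)"
proof -
  fix a b c d :: "fermion_word \<Rightarrow>\<^sub>0 'a"
  assume "clifford_eq a b" "clifford_eq c d"
  then have "(a - b) + - (c - d) \<in> two_sided_ideal clifford_relators"
    unfolding clifford_eq_def by (intro two_sided_ideal.add two_sided_ideal_uminus)
  then show "clifford_eq (a - c) (b - d)"
    unfolding clifford_eq_def by (simp add: algebra_simps)
qed

lift_definition times_clifford :: "'a clifford \<Rightarrow> 'a clifford \<Rightarrow> 'a clifford" is "(*)"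
proof -
  fix a b c d :: "fermion_word \<Rightarrow>\<^sub>0 'a"
  assume "clifford_eq a b" "clifford_eq c d"
  then have "(a - b) * c + b * (c - d) \<in> two_sided_ideal clifford_relators"
    unfolding clifford_eq_def
    by (intro two_sided_ideal.add two_sided_ideal_mult_left two_sided_ideal_mult_right)
  then show "clifford_eq (a * c) (b * d)"
    unfolding clifford_eq_def by (simp add: algebra_simps)
qed

instance
proof
  fix a b c :: "'a clifford"
  show "a + b + c = a + (b + c)" by transfer (simp add: clifford_eq_def add.assoc two_sided_ideal.zero)
  show "a + b = b + a" by transfer (simp add: clifford_eq_def add.commute two_sided_ideal.zero)
  show "0 + a = a" by transfer (simp add: clifford_eq_def two_sided_ideal.zero)
  show "- a + a = 0" by transfer (simp add: clifford_eq_def two_sided_ideal.zero)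
  show "a - b = a + - b" by transfer (simp add: clifford_eq_def two_sided_ideal.zero)
  show "a * b * c = a * (b * c)" by transfer (simp add: clifford_eq_def mult.assoc two_sided_ideal.zero)
  show "(a + b) * c = a * c + b * c" by transfer (simp add: clifford_eq_def distrib_right two_sided_ideal.zero)
  show "a * (b + c) = a * b + a * c" by transfer (simp add: clifford_eq_def distrib_left two_sided_ideal.zero)
  show "1 * a = a" by transfer (simp add: clifford_eq_def two_sided_ideal.zero)
  show "a * 1 = a" by transfer (simp add: clifford_eq_def two_sided_ideal.zero)
qed

end

lift_definition scalar :: "'k::field \<Rightarrow> 'k clifford" is free_scalar .

lift_definition psi :: "int \<Rightarrow> 'k::field clifford" is free_psi .

lift_definition psi_star :: "int \<Rightarrow> 'k::field clifford" is free_psi_star .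

lemma scalar_1: "scalar 1 = 1"
  by transfer (simp add: clifford_eq_def free_scalar_def two_sided_ideal.zero)

lemma scalar_add: "scalar (c + d) = scalar c + scalar d"
  by transfer (simp add: clifford_eq_def free_scalar_def single_add two_sided_ideal.zero)

lemma scalar_mult: "scalar (c * d) = scalar c * scalar d"
  by transfer (simp add: clifford_eq_def free_scalar_def mult_single two_sided_ideal.zero)

section \<open>The anti-involution\<close>

primrec fermion_swap :: "fermion \<Rightarrow> fermion" where
  "fermion_swap (Psi n) = Psi_star n"
| "fermion_swap (Psi_star n) = Psi n"

primrec word_star :: "fermion_word \<Rightarrow> fermion_word" where
  "word_star (Word u) = Word (rev (map fermion_swap u))"

lemma fermion_swap_swap [simp]: "fermion_swap (fermion_swap x) = x"
  by (cases x) simp_all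

lemma word_star_star [simp]: "word_star (word_star u) = u"
  by (cases u) (simp add: rev_map comp_def)

lemma inj_word_star: "inj word_star"
  by (metis injI word_star_star)

lemma word_star_add: "word_star (u + v) = word_star v + word_star u"
  by (cases u; cases v) simp

text \<open>As \<^const>\<open>word_star\<close> is an involution, reindexing the coefficients along it is the
  \<open>'k\<close>-linear extension of \<^const>\<open>word_star\<close>; see \<open>free_star_single\<close>.\<close>

definition free_star :: "(fermion_word \<Rightarrow>\<^sub>0 'k::field) \<Rightarrow> fermion_word \<Rightarrow>\<^sub>0 'k" where
  "free_star p = Poly_Mapping.map_key word_star p"

lemma free_star_single [simp]:
  "free_star (Poly_Mapping.single u c) = Poly_Mapping.single (word_star u) c"
  using map_key_single[OF inj_word_star, of "word_star u" c] by (simp add: free_star_def)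

lemma free_star_zero [simp]: "free_star 0 = 0"
  by (simp add: free_star_def map_key_zero[OF inj_word_star])

lemma free_star_add: "free_star (p + q) = free_star p + free_star q"
  by (simp add: free_star_def map_key_plus[OF inj_word_star])

lemma free_star_uminus: "free_star (- p) = - free_star p"
  using free_star_add[of p "- p"] by (simp add: eq_neg_iff_add_eq_0 add.commute)

lemma free_star_diff: "free_star (p - q) = free_star p - free_star q"
  using free_star_add[of p "- q"] by (simp add: free_star_uminus)

lemma free_alg_induct [case_names zero single add]:
  fixes p :: "fermion_word \<Rightarrow>\<^sub>0 'k::field"
  assumes "P 0" "\<And>u c. P (Poly_Mapping.single u c)" "\<And>p q. P p \<Longrightarrow> P q \<Longrightarrow> P (p + q)"
  shows "P p"
proof (induction p rule: Poly_Mapping.update_induct)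
  case const
  show ?case by (rule assms(1))
next
  case (update f a b)
  have "Poly_Mapping.update a b f = Poly_Mapping.single a b + f"
    using update(1)
    by (intro poly_mapping_eqI)
       (auto simp: lookup_update lookup_add lookup_single in_keys_iff when_def)
  then show ?case using assms(2,3) update by simp
qed

lemma free_star_mult: "free_star (p * q) = free_star q * free_star p"
proof (induction p rule: free_alg_induct)
  case (single u c)
  show ?case
    by (induction q rule: free_alg_induct)
       (simp_all add: mult_single word_star_add distrib_left distrib_right free_star_add mult.commute)
qed (simp_all add: free_star_add distrib_left distrib_right)

lemma free_star_relator:
  assumes "g \<in> clifford_relators"
  shows "free_star g \<in> clifford_relators"
proof -
  have psi: "free_star (free_psi n) = free_psi_star n" for n
    by (simp add: free_psi_def free_psi_star_def)
  have psi': "free_star (free_psi_star n) = free_psi n" for n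
    by (simp add: free_psi_def free_psi_star_def)
  have sc: "free_star (free_scalar c) = free_scalar c" for c
    by (simp add: free_scalar_def zero_fermion_word_def)
  from assms show ?thesis
    unfolding clifford_relators_def
    by (auto simp: free_star_add free_star_diff free_star_mult psi psi' sc) (metis add.commute)+
qed

lemma free_star_ideal:
  assumes "x \<in> two_sided_ideal clifford_relators"
  shows "free_star x \<in> two_sided_ideal clifford_relators"
  using assms
  by induction
     (auto simp: free_star_add free_star_mult mult.assoc[symmetric]
           intro: two_sided_ideal.intros free_star_relator)

lift_definition clifford_star :: "'k::field clifford \<Rightarrow> 'k clifford" is free_star
  unfolding clifford_eq_def by (metis free_star_diff free_star_ideal)

lemma clifford_star_psi: "clifford_star (psi n) = psi_star n"
  by transfer (simp add: clifford_eq_def free_psi_def free_psi_star_def two_sided_ideal.zero)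

lemma clifford_star_psi_star: "clifford_star (psi_star n) = psi n"
  by transfer (simp add: clifford_eq_def free_psi_def free_psi_star_def two_sided_ideal.zero)

lemma clifford_star_zero: "clifford_star 0 = 0"
  by transfer (simp add: clifford_eq_def two_sided_ideal.zero)

lemma clifford_star_add: "clifford_star (a + b) = clifford_star a + clifford_star b"
  by transfer (simp add: clifford_eq_def free_star_add two_sided_ideal.zero)

lemma clifford_star_diff: "clifford_star (a - b) = clifford_star a - clifford_star b"
  by transfer (simp add: clifford_eq_def free_star_diff two_sided_ideal.zero)

lemma clifford_star_mult: "clifford_star (a * b) = clifford_star b * clifford_star a"
  by transfer (simp add: clifford_eq_def free_star_mult two_sided_ideal.zero)

section \<open>The Fock space and its dual\<close>

lifting_forget clifford.lifting

definition annihilators :: "'k::field clifford set" where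
  "annihilators = {psi m | m. m < 0} \<union> {psi_star n | n. n \<ge> 0}"

definition creators :: "'k::field clifford set" where
  "creators = {psi n | n. n \<ge> 0} \<union> {psi_star m | m. m < 0}"

definition fock_eq :: "'k::field clifford \<Rightarrow> 'k clifford \<Rightarrow> bool" where
  "fock_eq a b \<longleftrightarrow> a - b \<in> left_ideal annihilators"

text \<open>The left module generated by the vacuum subject to the given relations; the class of \<open>a\<close>
  is \<open>a|0\<rangle>\<close>.\<close>

quotient_type (overloaded) 'k fock = "'k::field clifford" / fock_eq
  unfolding fock_eq_def[abs_def]
  by (intro equivp_diff_mem left_ideal.zero left_ideal.add left_ideal_uminus)

definition dual_fock_eq :: "'k::field clifford \<Rightarrow> 'k clifford \<Rightarrow> bool" where
  "dual_fock_eq a b \<longleftrightarrow> a - b \<in> right_ideal creators"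

text \<open>The right module; the class of \<open>a\<close> is \<open>\<langle>0|a\<close>.\<close>

quotient_type (overloaded) 'k dual_fock = "'k::field clifford" / dual_fock_eq
  unfolding dual_fock_eq_def[abs_def]
  by (intro equivp_diff_mem right_ideal.zero right_ideal.add right_ideal_uminus)

instantiation fock :: (field) ab_group_add
begin

lift_definition zero_fock :: "'a fock" is 0 .

lift_definition plus_fock :: "'a fock \<Rightarrow> 'a fock \<Rightarrow> 'a fock" is "(+)"
  unfolding fock_eq_def by (metis add_diff_add left_ideal.add)

lift_definition uminus_fock :: "'a fock \<Rightarrow> 'a fock" is uminus
  unfolding fock_eq_def by (metis minus_diff_minus left_ideal_uminus)

definition minus_fock :: "'a fock \<Rightarrow> 'a fock \<Rightarrow> 'a fock" where "minus_fock v w = v + - w"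

instance
proof
  fix a b c :: "'a fock"
  show "a + b + c = a + (b + c)" by transfer (simp add: fock_eq_def add.assoc left_ideal.zero)
  show "a + b = b + a" by transfer (simp add: fock_eq_def add.commute left_ideal.zero)
  show "0 + a = a" by transfer (simp add: fock_eq_def left_ideal.zero)
  show "- a + a = 0" by transfer (simp add: fock_eq_def left_ideal.zero)
  show "a - b = a + - b" by (rule minus_fock_def)
qed

end

instantiation dual_fock :: (field) ab_group_add
begin

lift_definition zero_dual_fock :: "'a dual_fock" is 0 .

lift_definition plus_dual_fock :: "'a dual_fock \<Rightarrow> 'a dual_fock \<Rightarrow> 'a dual_fock" is "(+)"
  unfolding dual_fock_eq_def by (metis add_diff_add right_ideal.add)

lift_definition uminus_dual_fock :: "'a dual_fock \<Rightarrow> 'a dual_fock" is uminus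
  unfolding dual_fock_eq_def by (metis minus_diff_minus right_ideal_uminus)

definition minus_dual_fock :: "'a dual_fock \<Rightarrow> 'a dual_fock \<Rightarrow> 'a dual_fock" where
  "minus_dual_fock v w = v + - w"

instance
proof
  fix a b c :: "'a dual_fock"
  show "a + b + c = a + (b + c)" by transfer (simp add: dual_fock_eq_def add.assoc right_ideal.zero)
  show "a + b = b + a" by transfer (simp add: dual_fock_eq_def add.commute right_ideal.zero)
  show "0 + a = a" by transfer (simp add: dual_fock_eq_def right_ideal.zero)
  show "- a + a = 0" by transfer (simp add: dual_fock_eq_def right_ideal.zero)
  show "a - b = a + - b" by (rule minus_dual_fock_def)
qed

end

lift_definition vacuum :: "'k::field fock" is 1 .

lift_definition dual_vacuum :: "'k::field dual_fock" is 1 .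

lift_definition left_act :: "'k::field clifford \<Rightarrow> 'k fock \<Rightarrow> 'k fock" is "(*)"
  unfolding fock_eq_def by (metis right_diff_distrib left_ideal_mult)

lift_definition right_act :: "'k::field dual_fock \<Rightarrow> 'k clifford \<Rightarrow> 'k dual_fock" is "(*)"
  unfolding dual_fock_eq_def by (metis left_diff_distrib right_ideal_mult)

definition fock_scale :: "'k::field \<Rightarrow> 'k fock \<Rightarrow> 'k fock" where
  "fock_scale c v = left_act (scalar c) v"

definition dual_fock_scale :: "'k::field \<Rightarrow> 'k dual_fock \<Rightarrow> 'k dual_fock" where
  "dual_fock_scale c w = right_act w (scalar c)"

lemma left_act_mult: "left_act (a * b) v = left_act a (left_act b v)"
  by transfer (simp add: fock_eq_def mult.assoc left_ideal.zero)

lemma left_act_add: "left_act (a + b) v = left_act a v + left_act b v"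
  by transfer (simp add: fock_eq_def distrib_right left_ideal.zero)

lemma left_act_add_right: "left_act a (v + w) = left_act a v + left_act a w"
  by transfer (simp add: fock_eq_def distrib_left left_ideal.zero)

lemma left_act_1: "left_act 1 v = v"
  by transfer (simp add: fock_eq_def left_ideal.zero)

lemma left_act_vacuum: "a \<in> annihilators \<Longrightarrow> left_act a vacuum = 0"
  by transfer (use left_ideal.gen[of _ annihilators 1] in \<open>simp add: fock_eq_def\<close>)

lemma right_act_mult: "right_act w (a * b) = right_act (right_act w a) b"
  by transfer (simp add: dual_fock_eq_def mult.assoc right_ideal.zero)

lemma right_act_add: "right_act w (a + b) = right_act w a + right_act w b"
  by transfer (simp add: dual_fock_eq_def distrib_left right_ideal.zero)

lemma right_act_add_left: "right_act (v + w) a = right_act v a + right_act w a"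
  by transfer (simp add: dual_fock_eq_def distrib_right right_ideal.zero)

lemma right_act_1: "right_act w 1 = w"
  by transfer (simp add: dual_fock_eq_def right_ideal.zero)

lemma right_act_dual_vacuum: "a \<in> creators \<Longrightarrow> right_act dual_vacuum a = 0"
  by transfer (use right_ideal.gen[of _ creators 1] in \<open>simp add: dual_fock_eq_def\<close>)

lemma vector_space_fock: "vector_space (fock_scale :: 'k::field \<Rightarrow> _)"
  by standard
     (simp_all add: fock_scale_def left_act_add_right left_act_add left_act_1
        scalar_1 scalar_add scalar_mult flip: left_act_mult)

lemma vector_space_dual_fock: "vector_space (dual_fock_scale :: 'k::field \<Rightarrow> _)"
  by standard
     (simp_all add: dual_fock_scale_def right_act_add_left right_act_add right_act_1
        scalar_1 scalar_add scalar_mult mult.commute flip: right_act_mult scalar_mult)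

lemma clifford_star_annihilator: "a \<in> annihilators \<Longrightarrow> clifford_star a \<in> creators"
  by (auto simp: annihilators_def creators_def clifford_star_psi clifford_star_psi_star)

lemma clifford_star_left_ideal:
  assumes "x \<in> left_ideal annihilators"
  shows "clifford_star x \<in> right_ideal creators"
  using assms
  by induction
     (auto simp: clifford_star_zero clifford_star_add clifford_star_mult
           intro: right_ideal.intros clifford_star_annihilator)

text \<open>The map \<open>a|0\<rangle> \<mapsto> \<langle>0|a\<^sup>*\<close>.\<close>

lift_definition transpose_fock :: "'k::field fock \<Rightarrow> 'k dual_fock" is clifford_star
  unfolding fock_eq_def dual_fock_eq_def
  by (metis clifford_star_diff clifford_star_left_ideal)

definition fock_pairing :: "'k::field dual_fock \<Rightarrow> 'k fock \<Rightarrow> 'k" where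
  "fock_pairing = (THE p.
     (\<forall>w. Vector_Spaces.linear fock_scale (*) (\<lambda>v. p w v)) \<and>
     (\<forall>v. Vector_Spaces.linear dual_fock_scale (*) (\<lambda>w. p w v)) \<and>
     p dual_vacuum vacuum = 1 \<and>
     (\<forall>w a v. p (right_act w a) v = p w (left_act a v)))"

section \<open>Shifted vacua and Heisenberg operators\<close>

primrec vacuum_up :: "nat \<Rightarrow> 'k::field fock" where
  "vacuum_up 0 = vacuum"
| "vacuum_up (Suc m) = left_act (psi (int m)) (vacuum_up m)"

primrec vacuum_down :: "nat \<Rightarrow> 'k::field fock" where
  "vacuum_down 0 = vacuum"
| "vacuum_down (Suc m) = left_act (psi_star (- int (Suc m))) (vacuum_down m)"

definition shifted_vacuum :: "int \<Rightarrow> 'k::field fock" where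
  "shifted_vacuum m = (if m \<ge> 0 then vacuum_up (nat m) else vacuum_down (nat (- m)))"

definition dual_shifted_vacuum :: "int \<Rightarrow> 'k::field dual_fock" where
  "dual_shifted_vacuum m = transpose_fock (shifted_vacuum m)"

text \<open>\<open>:\<psi>\<^sub>i\<psi>\<^sub>j\<^sup>*:\<close>\<close>

definition normal_ordered :: "int \<Rightarrow> int \<Rightarrow> 'k::field clifford" where
  "normal_ordered i j = psi i * psi_star j
     - scalar (fock_pairing dual_vacuum (left_act (psi i * psi_star j) vacuum))"

text \<open>The infinite sums below are locally finite: on each fixed vector only finitely many terms
  are nonzero, and \<^const>\<open>Sum_any\<close> adds up these. For \<open>t\<close> in \<open>'k\<close>, the operator \<open>H(t)\<close> strictly
  lowers the energy, hence is locally nilpotent and its exponential series is locally finite as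
  well.\<close>

definition heisenberg :: "int \<Rightarrow> 'k::field fock \<Rightarrow> 'k fock" where
  "heisenberg m v = Sum_any (\<lambda>i::int. left_act (normal_ordered i (i + m)) v)"

definition hamiltonian :: "'k::field_char_0 \<Rightarrow> 'k fock \<Rightarrow> 'k fock" where
  "hamiltonian t v =
     Sum_any (\<lambda>n::nat. if n > 0 then fock_scale (t ^ n / of_nat n) (heisenberg (int n) v) else 0)"

definition exp_op :: "('k::field_char_0 fock \<Rightarrow> 'k fock) \<Rightarrow> 'k fock \<Rightarrow> 'k fock" where
  "exp_op T v = Sum_any (\<lambda>j::nat. fock_scale (1 / fact j) ((T ^^ j) v))"

section \<open>Partitions and the deformed bases\<close>

text \<open>A partition is the list of its nonzero parts, so that its number of nonzero parts is its
  length; parts are indexed from 1.\<close>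

definition is_partition :: "nat list \<Rightarrow> bool" where
  "is_partition lam \<longleftrightarrow> sorted_wrt (\<ge>) lam \<and> 0 \<notin> set lam"

definition part :: "nat list \<Rightarrow> nat \<Rightarrow> nat" where
  "part lam i = (if 1 \<le> i \<and> i \<le> length lam then lam ! (i - 1) else 0)"

text \<open>The operator \<open>\<psi>\<^bsub>\<lambda>\<^sub>1 - 1\<^esub> e\<^bsup>H(t\<^sub>1)\<^esup> \<cdots> \<psi>\<^bsub>\<lambda>\<^sub>r - r\<^esub> e\<^bsup>H(t\<^sub>r)\<^esup>\<close>.\<close>

primrec ket_chain :: "(nat \<Rightarrow> 'k::field_char_0) \<Rightarrow> nat list \<Rightarrow> nat \<Rightarrow> 'k fock \<Rightarrow> 'k fock" where
  "ket_chain t lam 0 = id"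
| "ket_chain t lam (Suc r) =
     ket_chain t lam r \<circ> left_act (psi (int (part lam (Suc r)) - int (Suc r)))
       \<circ> exp_op (hamiltonian (t (Suc r)))"

definition deformed_ket :: "(nat \<Rightarrow> 'k::field_char_0) \<Rightarrow> nat list \<Rightarrow> nat \<Rightarrow> 'k fock" where
  "deformed_ket t lam r = ket_chain t lam r (shifted_vacuum (- int r))"

text \<open>The operator
  \<open>e\<^bsup>-H(t\<^sub>r)\<^esup> \<psi>\<^sup>*\<^bsub>\<mu>\<^sub>r - r\<^esub> \<cdots> e\<^bsup>-H(t\<^sub>1)\<^esup> \<psi>\<^sup>*\<^bsub>\<mu>\<^sub>1 - 1\<^esub>\<close>.\<close>

primrec bra_chain :: "(nat \<Rightarrow> 'k::field_char_0) \<Rightarrow> nat list \<Rightarrow> nat \<Rightarrow> 'k fock \<Rightarrow> 'k fock" where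
  "bra_chain t mu 0 = id"
| "bra_chain t mu (Suc r) =
     exp_op (\<lambda>v. - hamiltonian (t (Suc r)) v)
       \<circ> left_act (psi_star (int (part mu (Suc r)) - int (Suc r))) \<circ> bra_chain t mu r"

text \<open>Applied to a bra from the right, \<open>e\<^bsup>-H(t)\<^esup>\<close> produces in general an infinite linear combination
  (already \<open>\<langle>0|e\<^bsup>-H(t)\<^esup>\<close> is one). Bras are therefore read as linear functionals on the Fock space
  by means of the pairing, on which an operator acts from the right by precomposition; on elements
  of the Clifford algebra this is \<^const>\<open>right_act\<close>, by the adjunction property of the pairing.\<close>

definition deformed_bra :: "(nat \<Rightarrow> 'k::field_char_0) \<Rightarrow> nat list \<Rightarrow> nat \<Rightarrow> 'k fock \<Rightarrow> 'k" where
  "deformed_bra t mu r = fock_pairing (dual_shifted_vacuum (- int r)) \<circ> bra_chain t mu r"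

end

theory Submission
  imports Defs "HOL-Library.FSet" "HOL-Computational_Algebra.Formal_Power_Series"
begin

text \<open>Conjugating by \<open>e\<^bsup>H(t)\<^esup>\<close> replaces \<open>\<psi>\<^sup>*\<^sub>n\<close> by \<open>\<psi>\<^sup>*\<^sub>n - t \<psi>\<^sup>*\<^bsub>n+1\<^esub>\<close>, and conjugating by \<open>e\<^bsup>-H(t)\<^esup>\<close>
  replaces \<open>\<psi>\<^sub>n\<close> by \<open>\<psi>\<^sub>n - t \<psi>\<^bsub>n-1\<^esub>\<close>. Hence a vector killed by all \<open>\<psi>\<^sup>*\<^sub>n\<close> with \<open>n \<ge> N\<close> remains so under
  \<open>e\<^bsup>H(t)\<^esup>\<close>, while for a functional killing the images of all \<open>\<psi>\<^sub>n\<close> with \<open>n \<ge> N\<close> the bound becomes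
  \<open>N + 1\<close> under \<open>e\<^bsup>-H(t)\<^esup>\<close>. So \<open>\<psi>\<^sup>*\<^bsub>\<mu>\<^sub>1-1\<^esub>\<close> kills the ket of \<open>\<lambda>\<close> if \<open>\<lambda>\<^sub>1 < \<mu>\<^sub>1\<close>, and the bra of \<open>\<mu>\<close> kills
  the image of \<open>\<psi>\<^bsub>\<lambda>\<^sub>1-1\<^esub>\<close> if \<open>\<lambda>\<^sub>1 > \<mu>\<^sub>1\<close>. If \<open>\<lambda>\<^sub>1 = \<mu>\<^sub>1\<close>, the two fermions contract to \<open>1\<close>, the factors
  \<open>e\<^bsup>-H(t\<^sub>1)\<^esup>\<close> and \<open>e\<^bsup>H(t\<^sub>1)\<^esup>\<close> cancel, and the first parts are stripped off. The argument works for every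
  \<open>r \<ge> \<ell>(\<mu>)\<close>. The pairing exists because the vacuum expectation value can be read off the
  Jordan--Wigner representation.\<close>

section \<open>Generators and spanning sets\<close>

primrec gen :: "fermion \<Rightarrow> 'k::field clifford" where
  "gen (Psi n) = psi n"
| "gen (Psi_star n) = psi_star n"

primrec creating :: "fermion \<Rightarrow> bool" where
  "creating (Psi n) \<longleftrightarrow> n \<ge> 0"
| "creating (Psi_star n) \<longleftrightarrow> n < 0"

primrec mode :: "fermion \<Rightarrow> int" where
  "mode (Psi n) = n"
| "mode (Psi_star n) = n"

text \<open>The mode and the type, creating or annihilating, together determine a generator;
  swapping keeps the mode and flips the type.\<close>

lemma fermion_swap_eq_iff: "y = fermion_swap x \<longleftrightarrow> mode x = mode y \<and> creating x \<noteq> creating y"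
  by (cases x; cases y) auto

lemma annihilators_eq: "annihilators = gen ` {x. \<not> creating x}"
proof -
  have "annihilators = gen ` (Psi ` {..<0} \<union> Psi_star ` {0..})"
    by (auto simp: annihilators_def image_Un image_image)
  also have "Psi ` {..<0} \<union> Psi_star ` {0..} = {x. \<not> creating x}"
  proof (intro set_eqI)
    fix x show "x \<in> Psi ` {..<0} \<union> Psi_star ` {0..} \<longleftrightarrow> x \<in> {x. \<not> creating x}"
      by (cases x) auto
  qed
  finally show ?thesis .
qed

lemma creators_eq: "creators = gen ` {x. creating x}"
proof -
  have "creators = gen ` (Psi ` {0..} \<union> Psi_star ` {..<0})"
    by (auto simp: creators_def image_Un image_image)
  also have "Psi ` {0..} \<union> Psi_star ` {..<0} = {x. creating x}"
  proof (intro set_eqI)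
    fix x show "x \<in> Psi ` {0..} \<union> Psi_star ` {..<0} \<longleftrightarrow> x \<in> {x. creating x}"
      by (cases x) auto
  qed
  finally show ?thesis .
qed

section \<open>The Clifford relations as a single anticommutation rule\<close>

definition free_gen :: "fermion \<Rightarrow> fermion_word \<Rightarrow>\<^sub>0 'k::field" where
  "free_gen x = Poly_Mapping.single (Word [x]) 1"

definition free_anticomm :: "fermion \<Rightarrow> fermion \<Rightarrow> fermion_word \<Rightarrow>\<^sub>0 'k::field" where
  "free_anticomm x y = free_gen x * free_gen y + free_gen y * free_gen x
     - free_scalar (if y = fermion_swap x then 1 else 0)"

lemma free_scalar_0 [simp]: "free_scalar 0 = 0"
  by (simp add: free_scalar_def)

lemma free_anticomm_commute: "free_anticomm x y = free_anticomm y x"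
  by (auto simp: free_anticomm_def add.commute)

lemma gen_eq: "gen x = abs_clifford (free_gen x)"
  by (cases x) (simp_all add: psi.abs_eq psi_star.abs_eq free_gen_def free_psi_def free_psi_star_def)

text \<open>Since \<open>free_anticomm\<close> is symmetric, the order \<open>psi_star\<close>
  before \<open>psi\<close>, absent from \<open>clifford_relators\<close>, gives nothing
  new.\<close>

lemma clifford_relators_eq: "clifford_relators = range (\<lambda>(x, y). free_anticomm x y)"
proof -
  have *: "free_psi n = free_gen (Psi n)" "free_psi_star n = free_gen (Psi_star n)" for n
    by (simp_all add: free_gen_def free_psi_def free_psi_star_def)
  show ?thesis
  proof (intro equalityI subsetI)
    fix p :: "fermion_word \<Rightarrow>\<^sub>0 'a" assume "p \<in> clifford_relators"
    then consider m n where "p = free_anticomm (Psi m) (Psi n)"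
      | m n where "p = free_anticomm (Psi_star m) (Psi_star n)"
      | m n where "p = free_anticomm (Psi m) (Psi_star n)"
      unfolding clifford_relators_def * free_anticomm_def by (force simp: eq_commute)
    then show "p \<in> range (\<lambda>(x, y). free_anticomm x y)" by cases auto
  next
    fix p :: "fermion_word \<Rightarrow>\<^sub>0 'a" assume "p \<in> range (\<lambda>(x, y). free_anticomm x y)"
    then obtain x y where p: "p = free_anticomm x y" by auto
    have mixed: "free_anticomm (Psi m) (Psi_star n) \<in> clifford_relators" for m n
    proof -
      have "free_anticomm (Psi m) (Psi_star n) = free_gen (Psi m) * free_gen (Psi_star n)
          + free_gen (Psi_star n) * free_gen (Psi m) - free_scalar (if m = n then 1 else 0)"
        by (simp add: free_anticomm_def eq_commute)
      then show ?thesis unfolding clifford_relators_def * by blast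
    qed
    show "p \<in> clifford_relators"
    proof (cases x; cases y)
      fix m n assume "x = Psi m" "y = Psi_star n"
      then show ?thesis by (simp add: p mixed)
    next
      fix m n assume "x = Psi_star m" "y = Psi n"
      then show ?thesis by (simp add: p mixed free_anticomm_commute[of "Psi_star m"])
    qed (auto simp: p clifford_relators_def * free_anticomm_def)
  qed
qed

lemma abs_clifford_eq_0: "p \<in> two_sided_ideal clifford_relators \<Longrightarrow> abs_clifford p = 0"
  by (simp add: zero_clifford.abs_eq clifford.abs_eq_iff clifford_eq_def)

lemma scalar_0 [simp]: "scalar 0 = 0"
  by (simp add: scalar.abs_eq zero_clifford.abs_eq)

lemma gen_anticomm:
  "gen x * gen y + gen y * gen x = (scalar (if y = fermion_swap x then 1 else 0) :: 'k::field clifford)"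
proof -
  have "(free_anticomm x y :: fermion_word \<Rightarrow>\<^sub>0 'k) \<in> clifford_relators"
    by (auto simp: clifford_relators_eq)
  from two_sided_ideal.gen[OF this, of 1 1]
  have "abs_clifford (free_anticomm x y :: fermion_word \<Rightarrow>\<^sub>0 'k) = 0"
    by (intro abs_clifford_eq_0) simp
  then show ?thesis
    unfolding free_anticomm_def
    by (metis gen_eq minus_clifford.abs_eq plus_clifford.abs_eq times_clifford.abs_eq
        scalar.abs_eq eq_iff_diff_eq_0)
qed

lemma clifford_abs_cases [cases type: clifford]:
  obtains (abs) p where "a = abs_clifford p"
  by (induction a rule: clifford.abs_induct) blast

lemma scalar_commute: "scalar c * a = a * scalar c"
proof (cases a)
  case (abs p)
  have "free_scalar c * p = p * free_scalar c"
    by (induction p rule: free_alg_induct)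
       (simp_all add: free_scalar_def mult_single mult.commute distrib_left distrib_right)
  then show ?thesis by (simp add: abs scalar.abs_eq times_clifford.abs_eq)
qed

text \<open>Words are built up by left multiplication, the direction in which generators act on the
  Fock space.\<close>

lemma clifford_induct [case_names scalar gen add]:
  assumes "\<And>c. P (scalar c)" "\<And>x a. P a \<Longrightarrow> P (gen x * a)" "\<And>a b. P a \<Longrightarrow> P b \<Longrightarrow> P (a + b)"
  shows "P (a :: 'k::field clifford)"
proof (cases a)
  case (abs p)
  have "P (abs_clifford p)"
  proof (induction p rule: free_alg_induct)
    case zero
    show ?case using assms(1)[of 0] by (simp add: zero_clifford.abs_eq)
  next
    case (single u c)
    obtain xs where "u = Word xs" by (cases u)
    moreover have "P (abs_clifford (Poly_Mapping.single (Word xs) c))"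
    proof (induction xs)
      case Nil
      show ?case using assms(1)[of c]
        by (simp add: scalar.abs_eq free_scalar_def zero_fermion_word_def)
    next
      case (Cons x xs)
      have "abs_clifford (Poly_Mapping.single (Word (x # xs)) c)
          = gen x * abs_clifford (Poly_Mapping.single (Word xs) c)"
        by (simp add: gen_eq times_clifford.abs_eq free_gen_def mult_single)
      with assms(2)[OF Cons] show ?case by simp
    qed
    ultimately show ?case by simp
  next
    case (add p q)
    with assms(3) show ?case by (simp flip: plus_clifford.abs_eq)
  qed
  with abs show ?thesis by simp
qed

section \<open>The Fock space is spanned by products of creators on the vacuum\<close>

interpretation fock: vector_space fock_scale by (rule vector_space_fock)

interpretation dual_fock: vector_space dual_fock_scale by (rule vector_space_dual_fock)

abbreviation fock_linear :: "('k::field fock \<Rightarrow> 'k fock) \<Rightarrow> bool" where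
  "fock_linear \<equiv> Vector_Spaces.linear fock_scale fock_scale"

lemma fock_linearI:
  "(\<And>v w. T (v + w) = T v + T w) \<Longrightarrow> (\<And>c v. T (fock_scale c v) = fock_scale c (T v)) \<Longrightarrow> fock_linear T"
  by unfold_locales auto

lemma left_act_scale: "left_act a (fock_scale c v) = fock_scale c (left_act a v)"
  by (simp add: fock_scale_def scalar_commute flip: left_act_mult)

lemma fock_linear_left_act [simp, intro]: "fock_linear (left_act a)"
  by (rule fock_linearI) (simp_all add: left_act_add_right left_act_scale)

lemma left_act_zero_right [simp]: "left_act a 0 = 0"
  using left_act_add_right[of a 0 0] by simp

lemma left_act_minus_right: "left_act a (- v) = - left_act a v"
  using left_act_add_right[of a v "- v"] by (simp add: eq_neg_iff_add_eq_0 add.commute)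

lemma right_act_zero_left [simp]: "right_act 0 a = 0"
  using right_act_add_left[of 0 0 a] by simp

lemma left_act_abs_fock: "left_act a vacuum = abs_fock a"
  by (simp add: vacuum.abs_eq left_act.abs_eq)

lemma right_act_abs_dual_fock: "right_act dual_vacuum a = abs_dual_fock a"
  by (simp add: dual_vacuum.abs_eq right_act.abs_eq)

lemma left_act_gen_swap:
  "left_act (gen x) (left_act (gen y) v)
     = fock_scale (if y = fermion_swap x then 1 else 0) v - left_act (gen y) (left_act (gen x) v)"
  using arg_cong[OF gen_anticomm[of x y], of "\<lambda>a. left_act a v"]
  by (auto simp: left_act_add left_act_mult scalar_1 left_act_1 fock_scale_def eq_diff_eq)

lemma annihilator_vacuum: "\<not> creating x \<Longrightarrow> left_act (gen x) vacuum = 0"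
  by (intro left_act_vacuum) (auto simp: annihilators_eq)

lemma dual_vacuum_creator: "creating x \<Longrightarrow> right_act dual_vacuum (gen x) = 0"
  by (intro right_act_dual_vacuum) (auto simp: creators_eq)

inductive_set creator_span :: "'k::field fock set" where
  vacuum: "vacuum \<in> creator_span"
| creator: "v \<in> creator_span \<Longrightarrow> creating x \<Longrightarrow> left_act (gen x) v \<in> creator_span"
| add: "v \<in> creator_span \<Longrightarrow> w \<in> creator_span \<Longrightarrow> v + w \<in> creator_span"
| scale: "v \<in> creator_span \<Longrightarrow> fock_scale c v \<in> creator_span"

text \<open>An annihilator is moved to the right by the anticommutation rule until it reaches the
  vacuum, which it kills. The contractions left behind only shorten the product.\<close>

lemma creator_span_gen: "v \<in> creator_span \<Longrightarrow> left_act (gen x) v \<in> creator_span"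
proof (induction rule: creator_span.induct)
  case vacuum
  show ?case
    using creator_span.creator[OF creator_span.vacuum, of x]
      creator_span.scale[OF creator_span.vacuum, of 0]
    by (cases "creating x") (simp_all add: annihilator_vacuum)
next
  case (creator v y)
  \<comment> \<open>Here \<open>c\<close> stands for the contraction of the two generators, 0 or
    1.\<close>
  have "fock_scale c v + fock_scale (- 1) (left_act (gen y) (left_act (gen x) v)) \<in> creator_span" for c
    by (intro creator_span.intros creator)
  then show ?case by (simp add: left_act_gen_swap[of x y v])
qed (simp_all add: left_act_add_right left_act_scale creator_span.intros)

lemma creator_span_UNIV: "v \<in> creator_span"
proof -
  have "left_act a vacuum \<in> creator_span" for a :: "'a clifford"
  proof (induction a rule: clifford_induct)
    case (scalar c)
    show ?case using creator_span.scale[OF creator_span.vacuum] by (simp add: fock_scale_def)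
  qed (simp_all add: left_act_mult left_act_add creator_span_gen creator_span.add)
  then show ?thesis by (induction v rule: fock.abs_induct) (metis left_act_abs_fock)
qed

lemma fock_induct [case_names vacuum creator add scale]:
  assumes "P vacuum" "\<And>x v. creating x \<Longrightarrow> P v \<Longrightarrow> P (left_act (gen x) v)"
    and "\<And>v w. P v \<Longrightarrow> P w \<Longrightarrow> P (v + w)" "\<And>c v. P v \<Longrightarrow> P (fock_scale c v)"
  shows "P (v :: 'k::field fock)"
  using creator_span_UNIV[of v] by induction (auto intro: assms)

section \<open>The pairing\<close>

definition toggle :: "int \<Rightarrow> int fset \<Rightarrow> int fset" where
  "toggle n E = (if n |\<in>| E then E |-| {|n|} else finsert n E)"

text \<open>This sign is what makes operators of different modes anticommute.\<close>

definition jw_sign :: "int \<Rightarrow> int fset \<Rightarrow> 'k::field" where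
  "jw_sign n E = (- 1) ^ card (fset E \<inter> {..<n})"

text \<open>The Jordan--Wigner representation; a set lists the modes in which a state differs from the
  vacuum.\<close>

definition jw :: "fermion \<Rightarrow> (int fset \<Rightarrow> 'k::field) \<Rightarrow> int fset \<Rightarrow> 'k" where
  "jw x f E = (if (mode x |\<in>| E) = creating x then jw_sign (mode x) E * f (toggle (mode x) E) else 0)"

lemma toggle_toggle [simp]: "toggle n (toggle n E) = E"
  by (auto simp: toggle_def)

lemma toggle_commute: "toggle m (toggle n E) = toggle n (toggle m E)"
  by (auto simp: toggle_def)

lemma fmember_toggle: "m |\<in>| toggle n E \<longleftrightarrow> (m |\<in>| E) \<noteq> (m = n)"
  by (auto simp: toggle_def)

lemma jw_sign_square: "jw_sign n E * jw_sign n E = 1"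
  by (simp add: jw_sign_def flip: power_add)

lemma jw_sign_toggle: "jw_sign n (toggle m E) = (if m < n then - 1 else 1) * jw_sign n E"
proof (cases "m < n")
  case True
  show ?thesis
  proof (cases "m |\<in>| E")
    case m: True
    have "fset E \<inter> {..<n} = insert m (fset (toggle m E) \<inter> {..<n})"
      using m True by (auto simp: toggle_def)
    moreover have "m \<notin> fset (toggle m E) \<inter> {..<n}" using m by (simp add: toggle_def)
    ultimately show ?thesis using True by (simp add: jw_sign_def)
  next
    case m: False
    have "fset (toggle m E) \<inter> {..<n} = insert m (fset E \<inter> {..<n})"
      using m True by (auto simp: toggle_def)
    then show ?thesis using True m by (simp add: jw_sign_def)
  qed
next
  case False
  then have "fset (toggle m E) \<inter> {..<n} = fset E \<inter> {..<n}" by (auto simp: toggle_def)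
  with False show ?thesis by (simp add: jw_sign_def)
qed

text \<open>For equal modes the signs square to 1, and exactly one of the two orders survives if one
  generator creates and the other annihilates, none otherwise. For different modes the toggles
  commute, and exactly one of the two orders picks up an extra sign.\<close>

lemma jw_anticomm:
  "jw x (jw y f) E + jw y (jw x f) E = (if y = fermion_swap x then f E else 0)"
proof (cases "mode x = mode y")
  case True
  then show ?thesis
    by (auto simp: jw_def fmember_toggle fermion_swap_eq_iff jw_sign_toggle jw_sign_square
        simp flip: mult.assoc)
next
  case False
  then show ?thesis
    by (auto simp: jw_def fmember_toggle fermion_swap_eq_iff jw_sign_toggle toggle_commute[of "mode x"])
qed

primrec jw_word :: "fermion_word \<Rightarrow> (int fset \<Rightarrow> 'k::field) \<Rightarrow> int fset \<Rightarrow> 'k" where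
  "jw_word (Word xs) = foldr jw xs"

definition jw_free :: "(fermion_word \<Rightarrow>\<^sub>0 'k::field) \<Rightarrow> (int fset \<Rightarrow> 'k) \<Rightarrow> int fset \<Rightarrow> 'k" where
  "jw_free p f E = (\<Sum>u\<in>Poly_Mapping.keys p. Poly_Mapping.lookup p u * jw_word u f E)"

lemma jw_free_superset:
  "finite A \<Longrightarrow> Poly_Mapping.keys p \<subseteq> A \<Longrightarrow>
    jw_free p f E = (\<Sum>u\<in>A. Poly_Mapping.lookup p u * jw_word u f E)"
  unfolding jw_free_def by (rule sum.mono_neutral_left) (auto simp: in_keys_iff)

lemma jw_free_add: "jw_free (p + q) f E = jw_free p f E + jw_free q f E"
proof -
  let ?A = "Poly_Mapping.keys p \<union> Poly_Mapping.keys q"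
  have "Poly_Mapping.keys (p + q) \<subseteq> ?A" by (rule Poly_Mapping.keys_add)
  then show ?thesis
    by (simp add: jw_free_superset[of ?A] lookup_add distrib_right sum.distrib)
qed

lemma jw_free_0 [simp]: "jw_free 0 f E = 0"
  by (simp add: jw_free_def)

lemma jw_free_diff: "jw_free (p - q) f E = jw_free p f E - jw_free q f E"
  using jw_free_add[of "p - q" q] by simp

lemma jw_free_single: "jw_free (Poly_Mapping.single u c) f E = c * jw_word u f E"
  by (simp add: jw_free_superset[of "{u}"])

lemma jw_add: "jw x (\<lambda>E. f E + g E) = (\<lambda>E. jw x f E + jw x g E)"
  by (auto simp: jw_def fun_eq_iff distrib_left)

lemma jw_mult: "jw x (\<lambda>E. c * f E) = (\<lambda>E. c * jw x f E)"
  by (auto simp: jw_def fun_eq_iff)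

lemma jw_word_add: "jw_word u (\<lambda>E. f E + g E) = (\<lambda>E. jw_word u f E + jw_word u g E)"
proof (cases u)
  case (Word xs)
  show ?thesis unfolding Word by (induction xs) (simp_all add: jw_add)
qed

lemma jw_word_mult: "jw_word u (\<lambda>E. c * f E) = (\<lambda>E. c * jw_word u f E)"
proof (cases u)
  case (Word xs)
  show ?thesis unfolding Word by (induction xs) (simp_all add: jw_mult)
qed

lemma jw_free_mult: "jw_free (p * q) f E = jw_free p (jw_free q f) E"
proof (induction p rule: free_alg_induct)
  case (single u c)
  show ?case
  proof (induction q arbitrary: E rule: free_alg_induct)
    case zero
    have "jw_free 0 f = (\<lambda>E. 0 * f E)" by (simp add: fun_eq_iff)
    then show ?case by (simp only: jw_word_mult jw_free_single) simp
  next
    case (single v d)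
    have "jw_word (u + v) f = jw_word u (jw_word v f)" by (cases u; cases v) simp
    moreover have "jw_free (Poly_Mapping.single v d) f = (\<lambda>E. d * jw_word v f E)"
      by (simp add: fun_eq_iff jw_free_single)
    ultimately show ?case
      by (simp add: mult_single jw_free_single jw_word_mult)
  next
    case (add p q)
    have "jw_free (p + q) f = (\<lambda>E. jw_free p f E + jw_free q f E)"
      by (simp add: fun_eq_iff jw_free_add)
    with add show ?case by (simp add: jw_free_single jw_word_add distrib_left jw_free_add)
  qed
qed (simp_all add: distrib_right jw_free_add)

lemma jw_free_gen: "jw_free (free_gen x) f = jw x f"
  by (simp add: free_gen_def jw_free_single fun_eq_iff)

lemma jw_free_scalar: "jw_free (free_scalar c) f E = c * f E"
  by (simp add: free_scalar_def jw_free_single zero_fermion_word_def)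

lemma jw_free_ideal:
  "p \<in> two_sided_ideal clifford_relators \<Longrightarrow> jw_free p f E = 0"
proof (induction rule: two_sided_ideal.induct)
  case (gen g a b)
  then obtain x y where g: "g = free_anticomm x y" by (auto simp: clifford_relators_eq)
  \<comment> \<open>A relator acts as the zero element does, so it may be replaced by 0 inside a
    product.\<close>
  have "jw_free g h = jw_free 0 h" for h
    unfolding g free_anticomm_def
    by (rule ext) (simp add: jw_free_diff jw_free_add jw_free_mult jw_free_gen jw_free_scalar jw_anticomm)
  then have "jw_free (a * g * b) f E = jw_free (a * 0 * b) f E"
    by (simp only: jw_free_mult)
  then show ?case by simp
qed (simp_all add: jw_free_add)

text \<open>The indicator of the empty set represents the vacuum, and evaluation at the empty set
  reads off the vacuum coefficient. The value does not depend on the representative because the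
  ideal acts by zero.\<close>

definition vev :: "'k::field clifford \<Rightarrow> 'k" where
  "vev a = jw_free (rep_clifford a) (\<lambda>E. if E = {||} then 1 else 0) {||}"

lemma vev_abs: "vev (abs_clifford p) = jw_free p (\<lambda>E. if E = {||} then 1 else 0) {||}"
proof -
  have "clifford_eq (rep_clifford (abs_clifford p)) p"
    by (metis Quotient3_abs_rep Quotient3_clifford clifford.abs_eq_iff)
  then have "jw_free (rep_clifford (abs_clifford p) - p) f E = 0" for f E
    unfolding clifford_eq_def by (rule jw_free_ideal)
  then show ?thesis by (simp add: vev_def jw_free_diff)
qed

lemma vev_add: "vev (a + b) = vev a + vev b"
  by (cases a; cases b) (simp add: vev_abs plus_clifford.abs_eq jw_free_add)

lemma vev_diff: "vev (a - b) = vev a - vev b"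
  using vev_add[of "a - b" b] by simp

lemma vev_scalar: "vev (scalar c * a) = c * vev a"
  by (cases a) (simp add: vev_abs scalar.abs_eq times_clifford.abs_eq jw_free_mult jw_free_scalar)

lemma vev_1: "vev 1 = 1"
  using jw_free_scalar[of 1 "\<lambda>E. if E = {||} then 1 else 0" "{||}"]
  by (simp add: vev_abs scalar.abs_eq flip: scalar_1)

lemma vev_0 [simp]: "vev 0 = 0"
  using vev_scalar[of 0 0] by simp

text \<open>The image of a creator vanishes at every set without its mode, in particular at the
  empty set.\<close>

lemma vev_gen_left: "creating x \<Longrightarrow> vev (gen x * a) = 0"
  by (cases a) (simp add: gen_eq times_clifford.abs_eq vev_abs jw_free_mult jw_free_gen jw_def)

text \<open>An annihilator evaluates the vacuum indicator at sets that contain its mode, where the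
  indicator is 0.\<close>

lemma vev_gen_right: "\<not> creating x \<Longrightarrow> vev (a * gen x :: 'a::field clifford) = 0"
proof (cases a)
  case (abs p)
  assume "\<not> creating x"
  then have "jw x (\<lambda>E. if E = {||} then 1 else 0 :: 'a) = jw_free 0 (\<lambda>E. 0)"
    by (auto simp: fun_eq_iff jw_def toggle_def)
  then have "vev (a * gen x) = jw_free (p * 0) (\<lambda>E. 0) {||}"
    by (simp only: abs gen_eq times_clifford.abs_eq vev_abs jw_free_mult jw_free_gen)
  then show ?thesis by simp
qed

lemma vev_left_ideal: "a \<in> left_ideal annihilators \<Longrightarrow> vev (b * a) = 0"
  by (induction rule: left_ideal.induct)
     (auto simp: vev_add distrib_left annihilators_eq vev_gen_right simp flip: mult.assoc)

lemma vev_right_ideal: "a \<in> right_ideal creators \<Longrightarrow> vev (a * b) = 0"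
  by (induction rule: right_ideal.induct)
     (auto simp: vev_add distrib_right creators_eq vev_gen_left mult.assoc)

lift_definition vev_pairing :: "'k::field dual_fock \<Rightarrow> 'k fock \<Rightarrow> 'k" is "\<lambda>a b. vev (a * b)"
proof -
  fix a b c d :: "'k clifford"
  assume "dual_fock_eq a b" "fock_eq c d"
  \<comment> \<open>The difference of \<open>a * c\<close> and \<open>b * d\<close> splits into a
    part in the right ideal times \<open>c\<close> and \<open>b\<close> times a part in the left
    ideal.\<close>
  then have "vev ((a - b) * c + b * (c - d)) = 0"
    by (simp add: dual_fock_eq_def fock_eq_def vev_add vev_left_ideal vev_right_ideal)
  then show "vev (a * c) = vev (b * d)"
    by (simp add: algebra_simps vev_diff)
qed

section \<open>Existence and uniqueness of the pairing\<close>

definition is_pairing :: "('k::field dual_fock \<Rightarrow> 'k fock \<Rightarrow> 'k) \<Rightarrow> bool" where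
  "is_pairing p \<longleftrightarrow>
     (\<forall>w. Vector_Spaces.linear fock_scale (*) (\<lambda>v. p w v)) \<and>
     (\<forall>v. Vector_Spaces.linear dual_fock_scale (*) (\<lambda>w. p w v)) \<and>
     p dual_vacuum vacuum = 1 \<and>
     (\<forall>w a v. p (right_act w a) v = p w (left_act a v))"

lemma vector_space_field: "vector_space ((*) :: 'k::field \<Rightarrow> _)"
  by unfold_locales (simp_all add: algebra_simps)

lemma is_pairing_vev: "is_pairing vev_pairing"
  unfolding is_pairing_def
proof (intro conjI allI)
  fix w :: "'k::field dual_fock" and v :: "'k fock" and a :: "'k clifford"
  show "Vector_Spaces.linear fock_scale (*) (\<lambda>v. vev_pairing w v)"
  proof (intro Vector_Spaces.linear.intro vector_space_fock vector_space_field module_hom.intro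
      module_hom_axioms.intro fock.module_axioms)
    fix c :: 'k and v v' :: "'k fock"
    show "vev_pairing w (v + v') = vev_pairing w v + vev_pairing w v'"
      by transfer (simp add: distrib_left vev_add)
    show "vev_pairing w (fock_scale c v) = c * vev_pairing w v"
      unfolding fock_scale_def
      by transfer (metis scalar_commute mult.assoc vev_scalar)
    show "module ((*) :: 'k \<Rightarrow> _)" by unfold_locales (simp_all add: algebra_simps)
  qed
  show "Vector_Spaces.linear dual_fock_scale (*) (\<lambda>w. vev_pairing w v)"
  proof (intro Vector_Spaces.linear.intro vector_space_dual_fock vector_space_field module_hom.intro
      module_hom_axioms.intro dual_fock.module_axioms)
    fix c :: 'k and w w' :: "'k dual_fock"
    show "vev_pairing (w + w') v = vev_pairing w v + vev_pairing w' v"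
      by transfer (simp add: distrib_right vev_add)
    show "vev_pairing (dual_fock_scale c w) v = c * vev_pairing w v"
      unfolding dual_fock_scale_def
      by transfer (metis scalar_commute mult.assoc vev_scalar)
    show "module ((*) :: 'k \<Rightarrow> _)" by unfold_locales (simp_all add: algebra_simps)
  qed
  show "vev_pairing dual_vacuum (vacuum :: 'k fock) = 1" by transfer (simp add: vev_1)
  show "vev_pairing (right_act w a) v = vev_pairing w (left_act a v)"
    by transfer (simp add: mult.assoc)
qed

text \<open>Every bra is the dual vacuum acted on by some \<open>a\<close>, so adjointness reduces
  the claim to the dual vacuum. There, products with a leading creator pair to 0, which leaves only
  the normalization on the vacuum.\<close>

lemma is_pairing_unique:
  assumes p: "is_pairing (p :: 'a::field dual_fock \<Rightarrow> _)" and q: "is_pairing q"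
  shows "p = q"
proof (intro ext)
  have lin: "p w (v + v') = p w v + p w v'" "p w (fock_scale c v) = c * p w v" "p 0 v = 0"
    "p dual_vacuum vacuum = 1" "p (right_act w a) v = p w (left_act a v)"
    if "is_pairing p" for p :: "'a dual_fock \<Rightarrow> 'a fock \<Rightarrow> 'a" and w v v' c a
  proof -
    note * = that[unfolded is_pairing_def]
    from * interpret l: Vector_Spaces.linear fock_scale "(*)" "\<lambda>v. p w v" by blast
    from * interpret r: Vector_Spaces.linear dual_fock_scale "(*)" "\<lambda>w. p w v" by blast
    show "p w (v + v') = p w v + p w v'" "p w (fock_scale c v) = c * p w v" "p 0 v = 0"
      by (simp_all add: l.add l.scale)
    show "p dual_vacuum vacuum = 1" "p (right_act w a) v = p w (left_act a v)" using * by blast+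
  qed
  have dv: "p dual_vacuum v = q dual_vacuum v" for v
  proof (induction v rule: fock_induct)
    case (creator x v)
    have "r dual_vacuum (left_act (gen x) v) = 0" if "is_pairing r" for r
      using lin(5)[OF that, of dual_vacuum "gen x" v] creator lin(3)[OF that]
      by (simp add: dual_vacuum_creator)
    from this[OF p] this[OF q] show ?case by simp
  qed (simp_all add: lin[OF p] lin[OF q])
  fix w :: "'a dual_fock" and v
  obtain a where "w = right_act dual_vacuum a"
    by (induction w rule: dual_fock.abs_induct) (metis right_act_abs_dual_fock)
  then show "p w v = q w v" by (simp add: lin(5)[OF p] lin(5)[OF q] dv)
qed

lemma is_pairing_fock_pairing: "is_pairing (fock_pairing :: 'k::field dual_fock \<Rightarrow> _)"
proof -
  have *: "(fock_pairing :: 'k dual_fock \<Rightarrow> _) = (THE p. is_pairing p)"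
    unfolding fock_pairing_def is_pairing_def ..
  show ?thesis unfolding *
    by (rule theI[of is_pairing, OF is_pairing_vev]) (rule is_pairing_unique[OF _ is_pairing_vev])
qed

lemma linear_fock_pairing: "Vector_Spaces.linear fock_scale (*) (fock_pairing w)"
  and linear_fock_pairing_left: "Vector_Spaces.linear dual_fock_scale (*) (\<lambda>w. fock_pairing w v)"
  and fock_pairing_vacuum: "fock_pairing dual_vacuum vacuum = 1"
  and fock_pairing_adjoint: "fock_pairing (right_act w a) v = fock_pairing w (left_act a v)"
  using is_pairing_fock_pairing unfolding is_pairing_def by blast+

unbundle fps_syntax

section \<open>Conjugation by exponentials of locally nilpotent operators\<close>

lemma Sum_any_hom:
  assumes "f 0 = 0" "\<And>a b. f (a + b) = f a + f b" "finite {i. g i \<noteq> 0}"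
  shows "f (Sum_any g) = Sum_any (\<lambda>i. f (g i))"
proof -
  have "{i. f (g i) \<noteq> 0} \<subseteq> {i. g i \<noteq> 0}" using assms(1) by auto
  then have "Sum_any (\<lambda>i. f (g i)) = (\<Sum>i | g i \<noteq> 0. f (g i))"
    by (rule Sum_any.expand_superset[OF assms(3)])
  also have "\<dots> = f (\<Sum>i | g i \<noteq> 0. g i)"
    using sum_comp_morphism[of f g "{i. g i \<noteq> 0}"] assms(1,2) by (simp add: comp_def)
  finally show ?thesis by (simp add: Sum_any.expand_set)
qed

text \<open>The box \<open>i < M\<close>, \<open>l < K\<close> supports \<open>g\<close> and lies
  inside the triangle \<open>i + l < M + K\<close>.\<close>

lemma sum_triangle:
  fixes g :: "nat \<Rightarrow> nat \<Rightarrow> 'a::comm_monoid_add"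
  assumes "\<And>i l. M \<le> i \<or> K \<le> l \<Longrightarrow> g i l = 0"
  shows "(\<Sum>k<M + K. \<Sum>i\<le>k. g i (k - i)) = (\<Sum>i<M. \<Sum>l<K. g i l)"
proof -
  have "finite {(i, l). i + l < M + K}"
    by (rule finite_subset[of _ "{..<M + K} \<times> {..<M + K}"]) auto
  then have "(\<Sum>(i, l)\<in>{..<M} \<times> {..<K}. g i l) = (\<Sum>(i, l)\<in>{(i, l). i + l < M + K}. g i l)"
    using assms by (intro sum.mono_neutral_left) (auto simp: not_less, (meson not_le)+)
  also have "\<dots> = (\<Sum>k<M + K. \<Sum>i\<le>k. g i (k - i))" by (rule sum.triangle_reindex)
  finally show ?thesis by (simp add: sum.cartesian_product)
qed

section \<open>Exponentials of locally nilpotent linear maps\<close>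

lemma fock_linear_imp_module_hom: "fock_linear T \<Longrightarrow> module_hom fock_scale fock_scale T"
  by (simp add: Vector_Spaces.linear_def)

lemmas fock_linear_add = module_hom.add[OF fock_linear_imp_module_hom]
  and fock_linear_scale = module_hom.scale[OF fock_linear_imp_module_hom]
  and fock_linear_0 = module_hom.zero[OF fock_linear_imp_module_hom]
  and fock_linear_minus = module_hom.neg[OF fock_linear_imp_module_hom]
  and fock_linear_sum = module_hom.sum[OF fock_linear_imp_module_hom]

lemma fock_linear_uminus: "fock_linear T \<Longrightarrow> fock_linear (\<lambda>v. - T v)"
  by (rule fock_linearI) (simp_all add: fock_linear_add fock_linear_scale)

lemma fock_linear_funpow: "fock_linear T \<Longrightarrow> fock_linear (T ^^ k)"
proof (induction k)
  case 0
  show ?case by (rule fock_linearI) simp_all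
next
  case (Suc k)
  then show ?case by (intro fock_linearI) (simp_all add: fock_linear_add fock_linear_scale)
qed

lemma fock_linear_Sum_any:
  "fock_linear T \<Longrightarrow> finite {i. g i \<noteq> 0} \<Longrightarrow> T (Sum_any g) = Sum_any (\<lambda>i. T (g i))"
  by (rule Sum_any_hom) (simp_all add: fock_linear_0 fock_linear_add)

lemma funpow_eq_0_mono:
  assumes "fock_linear T" "(T ^^ K) v = 0" "K \<le> k"
  shows "(T ^^ k) v = 0"
proof -
  have "(T ^^ k) v = (T ^^ (k - K)) ((T ^^ K) v)"
    using funpow_add[of "k - K" K T] \<open>K \<le> k\<close> by simp
  then show ?thesis by (simp add: assms(2) fock_linear_0 fock_linear_funpow assms(1))
qed

lemma exp_op_eq_sum:
  assumes "fock_linear T" "(T ^^ K) v = 0"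
  shows "exp_op T v = (\<Sum>k<K. fock_scale (1 / fact k) ((T ^^ k) v))"
  unfolding exp_op_def using funpow_eq_0_mono[OF assms]
  by (intro Sum_any.expand_superset) (auto simp flip: not_le)

lemma linear_exp_op:
  assumes T: "fock_linear T" and nilpotent: "\<And>v. \<exists>K. (T ^^ K) v = 0"
  shows "fock_linear (exp_op T)"
proof (rule fock_linearI)
  fix v w
  obtain K K' where "(T ^^ K) v = 0" "(T ^^ K') w = 0" using nilpotent by blast
  then have v: "(T ^^ max K K') v = 0" and w: "(T ^^ max K K') w = 0"
    by (auto intro: funpow_eq_0_mono[OF T])
  then have vw: "(T ^^ max K K') (v + w) = 0"
    by (simp add: fock_linear_add[OF fock_linear_funpow[OF T]])
  show "exp_op T (v + w) = exp_op T v + exp_op T w"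
    unfolding exp_op_eq_sum[OF T v] exp_op_eq_sum[OF T w] exp_op_eq_sum[OF T vw]
    by (simp add: fock_linear_add[OF fock_linear_funpow[OF T]] fock.scale_right_distrib sum.distrib)
next
  fix c v
  obtain K where K: "(T ^^ K) v = 0" using nilpotent by blast
  then have cK: "(T ^^ K) (fock_scale c v) = 0"
    by (simp add: fock_linear_scale[OF fock_linear_funpow[OF T]])
  show "exp_op T (fock_scale c v) = fock_scale c (exp_op T v)"
    unfolding exp_op_eq_sum[OF T K] exp_op_eq_sum[OF T cK]
    by (simp add: fock_linear_scale[OF fock_linear_funpow[OF T]] fock.scale_sum_right mult.commute)
qed

lemma exp_op_fixed: "T v = 0 \<Longrightarrow> fock_linear T \<Longrightarrow> exp_op T v = v"
  by (simp add: exp_op_eq_sum[where K = 1])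

lemma funpow_uminus:
  assumes "fock_linear T"
  shows "((\<lambda>v. - T v) ^^ k) v = fock_scale ((- 1) ^ k) ((T ^^ k) v)"
  by (induction k) (simp_all add: fock_linear_scale assms fock_linear_minus)

text \<open>After regrouping the double sum by total degree, the scalar in front of
  \<open>T ^^ k\<close> is the coefficient of degree \<open>k\<close> in
  \<open>exp(-X) exp(X) = 1\<close>.\<close>

lemma exp_op_uminus_exp_op:
  assumes T: "fock_linear T" and K: "(T ^^ K) v = 0"
  shows "exp_op (\<lambda>v. - T v) (exp_op T v) = v"
proof -
  define g where "g i l = fock_scale ((- 1) ^ i / (fact i * fact l)) ((T ^^ (i + l)) v)" for i l
  have pow: "(T ^^ i) (exp_op T v) = (\<Sum>l<K. fock_scale (1 / fact l) ((T ^^ (i + l)) v))" for i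
    by (simp add: exp_op_eq_sum[OF assms] fock_linear_sum fock_linear_scale fock_linear_funpow T funpow_add)
  have g0: "g i l = 0" if "K \<le> i \<or> K \<le> l" for i l
    using that by (auto simp: g_def funpow_eq_0_mono[OF assms])
  have "(T ^^ K) (exp_op T v) = 0"
    unfolding pow by (simp add: funpow_eq_0_mono[OF assms])
  then have "exp_op (\<lambda>v. - T v) (exp_op T v)
      = (\<Sum>i<K. fock_scale (1 / fact i) (((\<lambda>v. - T v) ^^ i) (exp_op T v)))"
    by (intro exp_op_eq_sum fock_linear_uminus T) (simp add: funpow_uminus T)
  also have "\<dots> = (\<Sum>i<K. \<Sum>l<K. g i l)"
    by (simp add: funpow_uminus T pow g_def fock.scale_sum_right)
  also have "\<dots> = (\<Sum>k<K + K. \<Sum>i\<le>k. g i (k - i))"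
    by (rule sum_triangle[symmetric]) (rule g0)
  also have "\<dots> = (\<Sum>k<K + K. if k = 0 then v else 0)"
  proof (rule sum.cong[OF refl])
    fix k
    have "(\<Sum>i\<le>k. g i (k - i)) = fock_scale (\<Sum>i\<le>k. (- 1) ^ i / (fact i * fact (k - i))) ((T ^^ k) v)"
      by (simp add: g_def fock.scale_sum_left)
    also have "(\<Sum>i\<le>k. (- 1) ^ i / (fact i * fact (k - i))) = (fps_exp (- 1) * fps_exp (1::'a)) $ k"
      by (simp add: fps_mult_nth atLeast0AtMost)
    also have "fps_exp (- 1) * fps_exp (1::'a) = 1"
      by (simp flip: fps_exp_add_mult)
    finally show "(\<Sum>i\<le>k. g i (k - i)) = (if k = 0 then v else 0)" by simp
  qed
  also have "\<dots> = v" using K by (cases K) (simp_all add: sum.delta)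
  finally show ?thesis .
qed

section \<open>The formal series \<open>log (1 - t X)\<close>, whose negated coefficients are the
  weights of the Hamiltonian\<close>

definition fps_log_one_minus :: "'k::field_char_0 \<Rightarrow> 'k fps" where
  "fps_log_one_minus t = Abs_fps (\<lambda>n. if n = 0 then 0 else - (t ^ n / of_nat n))"

text \<open>The composite \<open>F\<close> satisfies the differential equation
  \<open>(1 - t X) F' = - t F\<close> with \<open>F(0) = 1\<close>, which determines its
  coefficients recursively.\<close>

lemma fps_exp_compose_log_one_minus:
  "fps_exp 1 oo fps_log_one_minus t = 1 - fps_const t * fps_X" (is "?F = ?G")
proof (rule fps_ext)
  fix n
  have L: "?G * fps_deriv (fps_log_one_minus t) = - fps_const t"
  proof (rule fps_ext)
    fix n
    show "(?G * fps_deriv (fps_log_one_minus t)) $ n = (- fps_const t) $ n"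
      by (cases n) (simp_all add: fps_log_one_minus_def left_diff_distrib mult.assoc del: of_nat_Suc)
  qed
  define F where "F = ?F"
  have "fps_deriv F = F * fps_deriv (fps_log_one_minus t)"
    unfolding F_def by (subst fps_compose_deriv) (simp_all add: fps_log_one_minus_def)
  then have "?G * fps_deriv F = F * (?G * fps_deriv (fps_log_one_minus t))"
    by (simp only: mult_ac)
  then have "fps_deriv F - fps_const t * (fps_X * fps_deriv F) = - (fps_const t * F)"
    unfolding L by (simp add: left_diff_distrib mult.assoc mult.commute[of F] del: fps_const_neg)
  then have eq: "(fps_deriv F - fps_const t * (fps_X * fps_deriv F)) $ n = (- (fps_const t * F)) $ n" for n
    by simp
  have F0: "F $ 0 = 1" by (simp add: F_def)
  have F1: "F $ Suc 0 = - t" using eq[of 0] F0 by simp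
  \<comment> \<open>For \<open>n = 0\<close> the right-hand side vanishes, which cuts the series off
    after degree 1.\<close>
  have rec: "of_nat (Suc (Suc n)) * F $ Suc (Suc n) = t * of_nat n * F $ Suc n" for n
    using eq[of "Suc n"] by (simp add: algebra_simps)
  have F2: "F $ Suc (Suc m) = 0" for m
  proof (induction m)
    case 0
    show ?case using rec[of 0] by simp
  next
    case (Suc m)
    with rec[of "Suc m"] show ?case by (simp del: of_nat_Suc)
  qed
  show "?F $ n = ?G $ n"
    unfolding F_def[symmetric] using F0 F1 F2[of "n - 2"]
    by (cases n; cases "n - 1") simp_all
qed

text \<open>The commutator with \<open>T\<close> acts on the family \<open>x\<close> as \<open>log (1 - t S)\<close>, \<open>S\<close> being the index shift;
  so conjugation by the exponential of \<open>T\<close> acts as \<open>1 - t S\<close>.\<close>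

locale log_shift =
  fixes T :: "'k::field_char_0 fock \<Rightarrow> 'k fock" and x :: "int \<Rightarrow> 'k fock \<Rightarrow> 'k fock" and t :: 'k
  assumes linear_T: "fock_linear T"
    and linear_x: "fock_linear (x j)"
    and bounded: "\<exists>N. \<forall>j\<ge>N. x j v = 0"
    and commutator: "T (x j v) = x j (T v)
      + Sum_any (\<lambda>n. fock_scale (fps_log_one_minus t $ n) (x (j + int n) v))"
begin

text \<open>The power series \<open>A\<close> in the index shift, applied to the family
  \<open>x\<close> at index \<open>j\<close>.\<close>

definition shift_act :: "'k fps \<Rightarrow> int \<Rightarrow> 'k fock \<Rightarrow> 'k fock" where
  "shift_act A j v = Sum_any (\<lambda>n. fock_scale (A $ n) (x (j + int n) v))"

lemma shift_act_eq_sum: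
  assumes "\<And>i. i \<ge> j + int M \<Longrightarrow> x i v = 0"
  shows "shift_act A j v = (\<Sum>n<M. fock_scale (A $ n) (x (j + int n) v))"
  unfolding shift_act_def using assms
  by (intro Sum_any.expand_superset) (auto simp flip: not_le)

text \<open>A common truncation bound, so that the sums belonging to several vectors become finite
  sums of the same length.\<close>

lemma nat_bounded: "\<exists>M. \<forall>v\<in>V. \<forall>i\<ge>j + int M. x i v = 0" if "finite V"
  using that
proof (induction V)
  case (insert v V)
  then obtain M where M: "\<forall>v\<in>V. \<forall>i\<ge>j + int M. x i v = 0" by blast
  obtain N where N: "\<forall>i\<ge>N. x i v = 0" using bounded by blast
  have "\<forall>u\<in>insert v V. \<forall>i\<ge>j + int (max M (nat (N - j))). x i u = 0"
    using M N by auto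
  then show ?case by blast
qed simp

lemma linear_shift_act: "fock_linear (shift_act A j)"
proof (rule fock_linearI)
  fix v w
  obtain M where M: "\<forall>u\<in>{v, w, v + w}. \<forall>i\<ge>j + int M. x i u = 0"
    using nat_bounded[of "{v, w, v + w}" j] by blast
  then show "shift_act A j (v + w) = shift_act A j v + shift_act A j w"
    by (simp add: shift_act_eq_sum[of j M] fock_linear_add[OF linear_x] fock.scale_right_distrib sum.distrib)
next
  fix c v
  obtain M where M: "\<forall>u\<in>{v, fock_scale c v}. \<forall>i\<ge>j + int M. x i u = 0"
    using nat_bounded[of "{v, fock_scale c v}" j] by blast
  then show "shift_act A j (fock_scale c v) = fock_scale c (shift_act A j v)"
    by (simp add: shift_act_eq_sum[of j M] fock_linear_scale[OF linear_x] fock.scale_sum_right mult.commute)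
qed

lemma shift_act_const_mult: "shift_act (fps_const c * A) j v = fock_scale c (shift_act A j v)"
proof -
  obtain M where M: "\<forall>u\<in>{v}. \<forall>i\<ge>j + int M. x i u = 0"
    using nat_bounded[of "{v}" j] by blast
  then show ?thesis by (simp add: shift_act_eq_sum[of j M] fock.scale_sum_right)
qed

text \<open>The commutator replaces each \<open>x\<close> by the logarithm of the shift applied to
  it; collecting equal indices is the Cauchy product of \<open>A\<close> with the logarithm.\<close>

lemma T_shift_act: "T (shift_act A j v) = shift_act A j (T v) + shift_act (A * fps_log_one_minus t) j v"
proof -
  let ?L = "fps_log_one_minus t"
  obtain M where "\<forall>u\<in>{v, T v}. \<forall>i\<ge>j + int M. x i u = 0"
    using nat_bounded[of "{v, T v}" j] by blast
  then have M: "x i v = 0" "x i (T v) = 0" if "i \<ge> j + int M" for i using that by auto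
  have "T (shift_act A j v) = shift_act A j (T v)
      + (\<Sum>n<M. fock_scale (A $ n) (shift_act ?L (j + int n) v))"
    by (simp add: shift_act_eq_sum[of j M, OF M(1)] shift_act_eq_sum[of j M, OF M(2)]
        fock_linear_sum[OF linear_T] fock_linear_scale[OF linear_T] commutator
        fock.scale_right_distrib sum.distrib flip: shift_act_def)
  also have "(\<Sum>n<M. fock_scale (A $ n) (shift_act ?L (j + int n) v))
      = (\<Sum>n<M. \<Sum>m<M. fock_scale (A $ n * ?L $ m) (x (j + int (n + m)) v))"
    by (simp add: shift_act_eq_sum[of _ M, OF M(1)] fock.scale_sum_right add.assoc)
  also have "\<dots> = (\<Sum>k<M + M. \<Sum>i\<le>k. fock_scale (A $ i * ?L $ (k - i)) (x (j + int (i + (k - i))) v))"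
    by (rule sum_triangle[symmetric]) (auto simp: M)
  also have "\<dots> = (\<Sum>k<M + M. fock_scale ((A * ?L) $ k) (x (j + int k) v))"
    by (simp add: fps_mult_nth atLeast0AtMost fock.scale_sum_left)
  also have "\<dots> = shift_act (A * ?L) j v"
    by (rule shift_act_eq_sum[symmetric]) (simp add: M)
  finally show ?thesis .
qed

text \<open>The term of order \<open>i\<close> in \<open>exp (log (1 - t X))\<close>; it describes
  the \<open>i\<close>-fold commutator with \<open>T\<close>, divided by \<open>i!\<close>.\<close>

definition exp_term :: "nat \<Rightarrow> 'k fps" where
  "exp_term i = fps_const (1 / fact i) * fps_log_one_minus t ^ i"

lemma exp_term_nth_eq_0: "n < i \<Longrightarrow> exp_term i $ n = 0"
  by (simp add: exp_term_def startsby_zero_power_prefix fps_log_one_minus_def)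

lemma exp_term_mult: "exp_term i * fps_log_one_minus t = fps_const (of_nat (Suc i)) * exp_term (Suc i)"
proof -
  have "fps_const (1 / fact i :: 'k) = fps_const (of_nat (Suc i)) * fps_const (1 / fact (Suc i))"
    by (simp add: fps_const_mult del: of_nat_Suc)
  then show ?thesis by (simp add: exp_term_def mult_ac)
qed

text \<open>The logarithm has no constant term, so its \<open>i\<close>-th power starts in degree
  \<open>i\<close>, and \<open>M\<close> terms of the exponential series already give all
  coefficients below \<open>M\<close>.\<close>

lemma sum_exp_term_nth:
  assumes "n < M"
  shows "(\<Sum>i<M. exp_term i $ n) = (1 - fps_const t * fps_X) $ n"
proof -
  have "(\<Sum>i<M. exp_term i $ n) = (\<Sum>i\<le>n. exp_term i $ n)"
    using assms by (intro sum.mono_neutral_right) (auto simp: exp_term_nth_eq_0)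
  then show ?thesis
    unfolding fps_exp_compose_log_one_minus[symmetric]
    by (simp add: fps_compose_nth exp_term_def atLeast0AtMost)
qed

text \<open>The Leibniz rule for iterated commutators, in divided powers so that no binomial
  coefficients occur.\<close>

lemma leibniz:
  "fock_scale (1 / fact k) ((T ^^ k) (x j v))
     = (\<Sum>i\<le>k. shift_act (exp_term i) j (fock_scale (1 / fact (k - i)) ((T ^^ (k - i)) v)))"
proof (induction k)
  case 0
  have "shift_act 1 j v = x j v"
  proof -
    have "{n. fock_scale ((1::'k fps) $ n) (x (j + int n) v) \<noteq> 0} \<subseteq> {0}" by auto
    then show ?thesis unfolding shift_act_def by (subst Sum_any.expand_superset[of "{0}"]) auto
  qed
  then show ?case by (simp add: exp_term_def)
next
  case (Suc k)
  define u where "u l = fock_scale (1 / fact l) ((T ^^ l) v)" for l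
  have step: "T (fock_scale (1 / fact l) ((T ^^ l) w)) = fock_scale (of_nat (Suc l)) (fock_scale (1 / fact (Suc l)) ((T ^^ Suc l) w))"
    for l w by (simp add: fock_linear_scale[OF linear_T] del: of_nat_Suc)
  define h where "h i = shift_act (exp_term i) j (u (Suc k - i))" for i
  have "fock_scale (of_nat (Suc k)) (fock_scale (1 / fact (Suc k)) ((T ^^ Suc k) (x j v)))
      = T (\<Sum>i\<le>k. shift_act (exp_term i) j (u (k - i)))"
    unfolding step[symmetric] Suc u_def ..
  also have "\<dots> = (\<Sum>i\<le>k. shift_act (exp_term i) j (T (u (k - i))))
      + (\<Sum>i\<le>k. fock_scale (of_nat (Suc i)) (shift_act (exp_term (Suc i)) j (u (k - i))))"
    by (simp add: fock_linear_sum[OF linear_T] T_shift_act exp_term_mult shift_act_const_mult sum.distrib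
        del: of_nat_Suc)
  also have "(\<Sum>i\<le>k. shift_act (exp_term i) j (T (u (k - i)))) = (\<Sum>i\<le>k. fock_scale (of_nat (Suc k - i)) (h i))"
  proof (rule sum.cong[OF refl])
    fix i assume "i \<in> {..k}"
    then have "Suc k - i = Suc (k - i)" by auto
    then show "shift_act (exp_term i) j (T (u (k - i))) = fock_scale (of_nat (Suc k - i)) (h i)"
      unfolding h_def u_def by (simp only: step fock_linear_scale[OF linear_shift_act])
  qed
  \<comment> \<open>The new summand \<open>i = Suc k\<close> has weight 0, as has
    \<open>i = 0\<close> in the next sum. Both sums then have the same range, and their weights add
    up to \<open>Suc k\<close>.\<close>
  also have "\<dots> = (\<Sum>i\<le>Suc k. fock_scale (of_nat (Suc k - i)) (h i))" by simp
  also have "(\<Sum>i\<le>k. fock_scale (of_nat (Suc i)) (shift_act (exp_term (Suc i)) j (u (k - i))))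
      = (\<Sum>i\<le>Suc k. fock_scale (of_nat i) (h i))"
    by (subst sum.atMost_Suc_shift) (simp add: h_def)
  also have "(\<Sum>i\<le>Suc k. fock_scale (of_nat (Suc k - i)) (h i)) + (\<Sum>i\<le>Suc k. fock_scale (of_nat i) (h i))
      = (\<Sum>i\<le>Suc k. fock_scale (of_nat (Suc k)) (h i))"
    unfolding sum.distrib[symmetric]
    by (rule sum.cong[OF refl]) (simp flip: fock.scale_left_distrib of_nat_add del: of_nat_Suc)
  also have "\<dots> = fock_scale (of_nat (Suc k)) (\<Sum>i\<le>Suc k. h i)"
    by (rule fock.scale_sum_right[symmetric])
  finally show ?case
    unfolding h_def u_def by (simp only: fock.scale_cancel_left of_nat_eq_0_iff) simp
qed

text \<open>Summing \<open>leibniz\<close> over \<open>k\<close> factors the exponential. The double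
  sum is finite: high orders of the commutator reach indices where \<open>x\<close> vanishes, and
  high powers of \<open>T\<close> kill \<open>v\<close>.\<close>

lemma exp_op_conjugation:
  assumes K: "(T ^^ K) v = 0"
  shows "\<exists>K. (T ^^ K) (x j v) = 0" (is ?nilp)
    and "exp_op T (x j v) = x j (exp_op T v) - fock_scale t (x (j + 1) (exp_op T v))" (is ?conj)
proof -
  define u where "u l = fock_scale (1 / fact l) ((T ^^ l) v)" for l
  obtain M0 where "\<forall>w\<in>insert (exp_op T v) (u ` {..<K}). \<forall>i\<ge>j + int M0. x i w = 0"
    using nat_bounded[of "insert (exp_op T v) (u ` {..<K})" j] by auto
  then have M0: "\<forall>w\<in>insert (exp_op T v) (u ` {..<K}). \<forall>i\<ge>j + int (max M0 2). x i w = 0"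
    by auto
  \<comment> \<open>At least 2, so that both coefficients of \<open>1 - t X\<close> lie in the range
    of summation.\<close>
  define M where "M = max M0 2"
  have M2: "2 \<le> M" by (simp add: M_def)
  note M0 = M0[folded M_def]
  have u0: "u l = 0" if "K \<le> l" for l
    using funpow_eq_0_mono[OF linear_T K that] by (simp add: u_def)
  have M: "x i (u l) = 0" if "j + int M \<le> i" for i l
    using M0 that u0[of l] by (cases "l < K") (auto simp: fock_linear_0[OF linear_x])
  have M': "x i (exp_op T v) = 0" if "j + int M \<le> i" for i using M0 that by auto
  define g where "g i l = shift_act (exp_term i) j (u l)" for i l
  have g_eq: "g i l = (\<Sum>n<M. fock_scale (exp_term i $ n) (x (j + int n) (u l)))" for i l
    unfolding g_def by (rule shift_act_eq_sum) (rule M)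
  have g0: "g i l = 0" if "M \<le> i \<or> K \<le> l" for i l
    using that by (auto simp: g_eq exp_term_nth_eq_0 u0 fock_linear_0[OF linear_x])
  have L: "fock_scale (1 / fact k) ((T ^^ k) (x j v)) = (\<Sum>i\<le>k. g i (k - i))" for k
    unfolding leibniz g_def u_def ..
  \<comment> \<open>If \<open>i + l = M + K\<close>, then \<open>M \<le> i\<close> or
    \<open>K \<le> l\<close>, so every summand vanishes.\<close>
  have "fock_scale (1 / fact (M + K)) ((T ^^ (M + K)) (x j v)) = 0"
    unfolding L by (rule sum.neutral) (auto intro!: g0)
  then have N: "(T ^^ (M + K)) (x j v) = 0" by simp
  then show ?nilp by blast
  have "exp_op T (x j v) = (\<Sum>k<M + K. \<Sum>i\<le>k. g i (k - i))"
    unfolding exp_op_eq_sum[OF linear_T N] L ..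
  also have "\<dots> = (\<Sum>i<M. \<Sum>l<K. g i l)" by (rule sum_triangle) (rule g0)
  also have "\<dots> = (\<Sum>i<M. shift_act (exp_term i) j (exp_op T v))"
    by (simp add: g_def exp_op_eq_sum[OF linear_T K] u_def fock_linear_sum[OF linear_shift_act])
  also have "\<dots> = (\<Sum>i<M. \<Sum>n<M. fock_scale (exp_term i $ n) (x (j + int n) (exp_op T v)))"
    by (simp add: shift_act_eq_sum[of j M, OF M'])
  also have "\<dots> = (\<Sum>n<M. fock_scale ((1 - fps_const t * fps_X) $ n) (x (j + int n) (exp_op T v)))"
    by (subst sum.swap) (simp add: sum_exp_term_nth flip: fock.scale_sum_left)
  also have "\<dots> = (\<Sum>n<2. fock_scale ((1 - fps_const t * fps_X) $ n) (x (j + int n) (exp_op T v)))"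
    using M2 by (intro sum.mono_neutral_right) auto
  also have "\<dots> = x j (exp_op T v) - fock_scale t (x (j + 1) (exp_op T v))"
    by (simp add: numeral_2_eq_2)
  finally show ?conj .
qed

end

section \<open>Heisenberg operators\<close>

lemma left_act_psi_star_psi:
  "left_act (psi_star i) (left_act (psi j) v) = (if i = j then v else 0) - left_act (psi j) (left_act (psi_star i) v)"
  using left_act_gen_swap[of "Psi_star i" "Psi j" v] by (auto split: if_splits)

lemma left_act_psi_psi_star:
  "left_act (psi i) (left_act (psi_star j) v) = (if i = j then v else 0) - left_act (psi_star j) (left_act (psi i) v)"
  using left_act_gen_swap[of "Psi i" "Psi_star j" v] by (auto split: if_splits)

lemma left_act_psi_psi: "left_act (psi i) (left_act (psi j) v) = - left_act (psi j) (left_act (psi i) v)"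
  using left_act_gen_swap[of "Psi i" "Psi j" v] by simp

lemma left_act_psi_star_psi_star:
  "left_act (psi_star i) (left_act (psi_star j) v) = - left_act (psi_star j) (left_act (psi_star i) v)"
  using left_act_gen_swap[of "Psi_star i" "Psi_star j" v] by simp

lemma psi_vacuum: "n < 0 \<Longrightarrow> left_act (psi n) vacuum = 0"
  using annihilator_vacuum[of "Psi n"] by simp

lemma psi_star_vacuum: "0 \<le> n \<Longrightarrow> left_act (psi_star n) vacuum = 0"
  using annihilator_vacuum[of "Psi_star n"] by simp

lemma dual_vacuum_psi: "0 \<le> n \<Longrightarrow> right_act dual_vacuum (psi n) = 0"
  using dual_vacuum_creator[of "Psi n"] by simp

lemma dual_vacuum_psi_star: "n < 0 \<Longrightarrow> right_act dual_vacuum (psi_star n) = 0"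
  using dual_vacuum_creator[of "Psi_star n"] by simp

lemma fock_bounded: "\<exists>N. \<forall>j\<ge>N. left_act (psi_star j) v = 0 \<and> left_act (psi (- j)) v = 0"
proof (induction v rule: fock_induct)
  case vacuum
  have "\<forall>j\<ge>1. left_act (psi_star j) vacuum = 0 \<and> left_act (psi (- j)) vacuum = 0"
    by (simp add: psi_vacuum psi_star_vacuum)
  then show ?case by blast
next
  case (creator x v)
  then obtain N where N: "\<forall>j\<ge>N. left_act (psi_star j) v = 0 \<and> left_act (psi (- j)) v = 0" by blast
  \<comment> \<open>For \<open>j\<close> beyond the absolute value of the mode, neither
    \<open>j\<close> nor \<open>- j\<close> is the mode of \<open>x\<close>, so there is no
    contraction.\<close>
  have "left_act (psi_star j) (left_act (gen x) v) = 0 \<and> left_act (psi (- j)) (left_act (gen x) v) = 0"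
    if "j \<ge> max N (1 + \<bar>mode x\<bar>)" for j
    using that N
    by (cases x) (auto simp: left_act_psi_star_psi left_act_psi_psi_star left_act_psi_psi[of "- j"]
        left_act_psi_star_psi_star[of j])
  then show ?case by blast
next
  case (add v w)
  then obtain N N' where
    "\<forall>j\<ge>N. left_act (psi_star j) v = 0 \<and> left_act (psi (- j)) v = 0"
    "\<forall>j\<ge>N'. left_act (psi_star j) w = 0 \<and> left_act (psi (- j)) w = 0" by blast
  then have "\<forall>j\<ge>max N N'. left_act (psi_star j) (v + w) = 0 \<and> left_act (psi (- j)) (v + w) = 0"
    by (simp add: left_act_add_right)
  then show ?case by blast
next
  case (scale c v)
  then show ?case by (auto simp: left_act_scale)
qed

lemma fock_pairing_0_left [simp]: "fock_pairing 0 v = 0"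
  by (metis linear_fock_pairing_left Vector_Spaces.linear_def module_hom.zero)

lemma fock_pairing_0_right [simp]: "fock_pairing w 0 = 0"
  by (metis linear_fock_pairing Vector_Spaces.linear_def module_hom.zero)

lemma fock_pairing_add: "fock_pairing w (u + v) = fock_pairing w u + fock_pairing w v"
  by (metis linear_fock_pairing Vector_Spaces.linear_def module_hom.add)

lemma fock_pairing_minus: "fock_pairing w (- v) = - fock_pairing w v"
  by (metis linear_fock_pairing Vector_Spaces.linear_def module_hom.neg)

lemma fock_pairing_diff: "fock_pairing w (u - v) = fock_pairing w u - fock_pairing w v"
  using fock_pairing_add[of w u "- v"] by (simp add: fock_pairing_minus)

lemma fock_pairing_scale: "fock_pairing w (fock_scale c v) = c * fock_pairing w v"
  by (metis linear_fock_pairing Vector_Spaces.linear_def module_hom.scale)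

text \<open>Makes the normal ordering correction vanish in the Heisenberg operators of nonzero
  index. For \<open>j < 0\<close> the swapped product has \<open>psi_star j\<close> next to the dual
  vacuum.\<close>

lemma vacuum_psi_psi_star: "i \<noteq> j \<Longrightarrow> fock_pairing dual_vacuum (left_act (psi i) (left_act (psi_star j) vacuum)) = 0"
proof (cases "j < 0")
  case True
  assume "i \<noteq> j"
  then have "fock_pairing dual_vacuum (left_act (psi i) (left_act (psi_star j) vacuum))
      = - fock_pairing (right_act dual_vacuum (psi_star j)) (left_act (psi i) vacuum)"
    by (simp add: left_act_psi_psi_star fock_pairing_minus fock_pairing_adjoint)
  with True show ?thesis by (simp add: dual_vacuum_psi_star)
qed (simp add: psi_star_vacuum)

lemma heisenberg_eq:
  "m \<noteq> 0 \<Longrightarrow> heisenberg m v = Sum_any (\<lambda>i. left_act (psi i) (left_act (psi_star (i + m)) v))"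
  by (simp add: heisenberg_def normal_ordered_def left_act_mult vacuum_psi_psi_star)

lemma finite_heisenberg:
  assumes "m \<noteq> 0"
  shows "finite {i. left_act (psi i) (left_act (psi_star (i + m)) v) \<noteq> 0}"
proof -
  obtain N where N: "\<forall>j\<ge>N. left_act (psi_star j) v = 0 \<and> left_act (psi (- j)) v = 0"
    using fock_bounded by blast
  have "left_act (psi i) (left_act (psi_star (i + m)) v) = 0" if "i \<notin> {- N..N - m}" for i
  proof (cases "i < - N")
    case True
    then have "left_act (psi i) v = 0" using N[rule_format, of "- i"] by simp
    then show ?thesis using assms by (simp add: left_act_psi_psi_star)
  next
    case False
    with that N show ?thesis by simp
  qed
  then have "{i. left_act (psi i) (left_act (psi_star (i + m)) v) \<noteq> 0} \<subseteq> {- N..N - m}" by blast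
  then show ?thesis using finite_subset by blast
qed

lemma heisenberg_eventually_0: "\<exists>M. \<forall>m\<ge>M. heisenberg (int m) v = 0"
proof -
  obtain N where N: "\<forall>j\<ge>N. left_act (psi_star j) v = 0 \<and> left_act (psi (- j)) v = 0"
    using fock_bounded by blast
  \<comment> \<open>From \<open>2 * N\<close> on, every \<open>i\<close> satisfies
    \<open>i \<le> - N\<close> or \<open>i + m \<ge> N\<close>; the maximum with 1 keeps the index
    nonzero.\<close>
  have "heisenberg (int m) v = 0" if "m \<ge> max 1 (nat (2 * N))" for m
  proof -
    have "left_act (psi i) (left_act (psi_star (i + int m)) v) = 0" for i
    proof (cases "i \<le> - N")
      case True
      then have "left_act (psi i) v = 0" using N[rule_format, of "- i"] by simp
      then show ?thesis using that by (simp add: left_act_psi_psi_star)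
    next
      case False
      with that have "N \<le> i + int m" by linarith
      with N show ?thesis by simp
    qed
    then show ?thesis using that by (simp add: heisenberg_eq)
  qed
  then show ?thesis by blast
qed

lemma linear_heisenberg:
  assumes "m \<noteq> 0"
  shows "fock_linear (heisenberg m)"
  by (rule fock_linearI)
     (simp_all add: heisenberg_eq assms left_act_add_right Sum_any.distrib finite_heisenberg
       left_act_scale fock_linear_Sum_any[where T = "fock_scale c" for c] fock_linearI
       fock.scale_right_distrib mult.commute)

lemma heisenberg_psi:
  assumes "m \<noteq> 0"
  shows "heisenberg m (left_act (psi j) v) = left_act (psi j) (heisenberg m v) + left_act (psi (j - m)) v"
proof -
  let ?f = "\<lambda>i. left_act (psi i) (left_act (psi_star (i + m)) v)"
  \<comment> \<open>The only contraction is that of \<open>psi_star (i + m)\<close> with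
    \<open>psi j\<close>, at \<open>i = j - m\<close>.\<close>
  have *: "left_act (psi i) (left_act (psi_star (i + m)) (left_act (psi j) v))
      = left_act (psi j) (?f i) + (if i = j - m then left_act (psi (j - m)) v else 0)" for i
    by (auto simp: left_act_psi_star_psi left_act_psi_psi[of i j] left_act_minus_right
        left_act_add_right diff_conv_add_uminus simp del: add_uminus_conv_diff)
  have "finite {i. left_act (psi j) (?f i) \<noteq> 0}"
    by (rule finite_subset[OF _ finite_heisenberg[OF assms, of v]]) auto
  moreover have "finite {i. (if i = j - m then left_act (psi (j - m)) v else 0) \<noteq> 0}"
    by (rule finite_subset[of _ "{j - m}"]) auto
  ultimately have "heisenberg m (left_act (psi j) v) = Sum_any (\<lambda>i. left_act (psi j) (?f i))
      + Sum_any (\<lambda>i. if i = j - m then left_act (psi (j - m)) v else 0)"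
    unfolding heisenberg_eq[OF assms] * by (rule Sum_any.distrib)
  then show ?thesis
    by (simp add: heisenberg_eq assms fock_linear_Sum_any finite_heisenberg Sum_any.delta)
qed

lemma heisenberg_psi_star:
  assumes "m \<noteq> 0"
  shows "heisenberg m (left_act (psi_star j) v)
    = left_act (psi_star j) (heisenberg m v) - left_act (psi_star (j + m)) v"
proof -
  let ?f = "\<lambda>i. left_act (psi i) (left_act (psi_star (i + m)) v)"
  \<comment> \<open>Now \<open>psi i\<close> contracts with \<open>psi_star j\<close>, after
    \<open>psi_star j\<close> has passed \<open>psi_star (i + m)\<close>; hence the minus
    sign.\<close>
  have *: "left_act (psi i) (left_act (psi_star (i + m)) (left_act (psi_star j) v))
      = left_act (psi_star j) (?f i) + (if i = j then - left_act (psi_star (j + m)) v else 0)" for i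
    by (auto simp: left_act_psi_psi_star left_act_psi_star_psi_star[of "i + m" j] left_act_minus_right)
  have "finite {i. left_act (psi_star j) (?f i) \<noteq> 0}"
    by (rule finite_subset[OF _ finite_heisenberg[OF assms, of v]]) auto
  moreover have "finite {i. (if i = j then - left_act (psi_star (j + m)) v else 0) \<noteq> 0}"
    by (rule finite_subset[of _ "{j}"]) auto
  ultimately have "heisenberg m (left_act (psi_star j) v) = Sum_any (\<lambda>i. left_act (psi_star j) (?f i))
      + Sum_any (\<lambda>i. if i = j then - left_act (psi_star (j + m)) v else 0)"
    unfolding heisenberg_eq[OF assms] * by (rule Sum_any.distrib)
  then show ?thesis
    by (simp add: heisenberg_eq assms fock_linear_Sum_any finite_heisenberg Sum_any.delta)
qed

lemma heisenberg_vacuum: "0 < m \<Longrightarrow> heisenberg m (vacuum :: 'k::field fock) = 0"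
proof -
  assume m: "0 < m"
  have "left_act (psi i) (left_act (psi_star (i + m)) (vacuum :: 'k fock)) = 0" for i
    using m by (cases "i + m \<ge> 0") (simp_all add: psi_star_vacuum left_act_psi_psi_star psi_vacuum)
  with m show ?thesis by (simp add: heisenberg_eq)
qed

section \<open>The Hamiltonian\<close>

lemma finite_nonzero_nat: "\<forall>n\<ge>M. f n = 0 \<Longrightarrow> finite {n::nat. f n \<noteq> 0}"
  by (rule finite_subset[of _ "{..<M}"]) (use not_le in blast)+

lemma hamiltonian_eq:
  "hamiltonian t v = Sum_any (\<lambda>n. - fock_scale (fps_log_one_minus t $ n) (heisenberg (int n) v))"
  by (auto simp: hamiltonian_def fps_log_one_minus_def intro!: arg_cong[where f = Sum_any])

lemma finite_hamiltonian: "finite {n. - fock_scale (fps_log_one_minus t $ n) (heisenberg (int n) v) \<noteq> 0}"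
proof -
  obtain M where "\<forall>m\<ge>M. heisenberg (int m) v = 0" using heisenberg_eventually_0 by blast
  then show ?thesis by (intro finite_nonzero_nat[of M]) simp
qed

text \<open>The coefficient of degree 0 is 0, so identities for Heisenberg operators of positive
  index may be used under the sum.\<close>

lemma log_heisenberg_cong:
  assumes "0 < n \<Longrightarrow> v = w"
  shows "fock_scale (fps_log_one_minus t $ n) v = fock_scale (fps_log_one_minus t $ n) w"
  using assms by (cases n) (simp_all add: fps_log_one_minus_def)

lemma linear_hamiltonian: "fock_linear (hamiltonian t)"
proof (rule fock_linearI)
  fix v w :: "'a fock" and c
  let ?f = "\<lambda>v n. - fock_scale (fps_log_one_minus t $ n) (heisenberg (int n) v)"
  have "?f (v + w) n = ?f v n + ?f w n" for n
  proof -
    have "fock_scale (fps_log_one_minus t $ n) (heisenberg (int n) (v + w))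
        = fock_scale (fps_log_one_minus t $ n) (heisenberg (int n) v + heisenberg (int n) w)"
      by (rule log_heisenberg_cong) (simp add: fock_linear_add linear_heisenberg)
    then show ?thesis by (simp add: fock.scale_right_distrib)
  qed
  then show "hamiltonian t (v + w) = hamiltonian t v + hamiltonian t w"
    unfolding hamiltonian_eq by (simp only: Sum_any.distrib[OF finite_hamiltonian finite_hamiltonian])
  have "?f (fock_scale c v) n = fock_scale c (?f v n)" for n
  proof -
    have "fock_scale (fps_log_one_minus t $ n) (heisenberg (int n) (fock_scale c v))
        = fock_scale (fps_log_one_minus t $ n) (fock_scale c (heisenberg (int n) v))"
      by (rule log_heisenberg_cong) (simp add: fock_linear_scale linear_heisenberg)
    then show ?thesis by (simp add: mult.commute)
  qed
  moreover have "fock_linear (fock_scale c)"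
    by (rule fock_linearI) (simp_all add: fock.scale_right_distrib mult.commute)
  ultimately show "hamiltonian t (fock_scale c v) = fock_scale c (hamiltonian t v)"
    unfolding hamiltonian_eq by (simp only: fock_linear_Sum_any[OF _ finite_hamiltonian])
qed

text \<open>Adds up the commutators with the weights of the Hamiltonian; \<open>Y\<close> is a
  shifted \<open>psi_star\<close>, or a shifted \<open>psi\<close> with a minus sign.\<close>

lemma hamiltonian_commutator:
  assumes X: "fock_linear X" and Y: "\<exists>M. \<forall>n\<ge>M. Y n v = 0"
    and comm: "\<And>n. 0 < n \<Longrightarrow> heisenberg (int n) (X v) = X (heisenberg (int n) v) - Y n v"
  shows "hamiltonian t (X v) = X (hamiltonian t v) + Sum_any (\<lambda>n. fock_scale (fps_log_one_minus t $ n) (Y n v))"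
proof -
  let ?f = "\<lambda>n. - fock_scale (fps_log_one_minus t $ n) (heisenberg (int n) v)"
  have "- fock_scale (fps_log_one_minus t $ n) (heisenberg (int n) (X v))
      = X (?f n) + fock_scale (fps_log_one_minus t $ n) (Y n v)" for n
  proof -
    have "fock_scale (fps_log_one_minus t $ n) (heisenberg (int n) (X v))
        = fock_scale (fps_log_one_minus t $ n) (X (heisenberg (int n) v) - Y n v)"
      by (rule log_heisenberg_cong) (rule comm)
    then show ?thesis by (simp add: fock.scale_right_diff_distrib fock_linear_minus fock_linear_scale X)
  qed
  moreover have "finite {n. X (?f n) \<noteq> 0}"
    by (rule finite_subset[OF _ finite_hamiltonian[of t v]]) (auto simp: fock_linear_0 X)
  moreover obtain M where "\<forall>n\<ge>M. Y n v = 0" using Y by blast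
  then have "finite {n. fock_scale (fps_log_one_minus t $ n) (Y n v) \<noteq> 0}"
    by (intro finite_nonzero_nat[of M]) simp
  ultimately show ?thesis
    unfolding hamiltonian_eq by (simp add: Sum_any.distrib fock_linear_Sum_any[OF X finite_hamiltonian])
qed

lemma eventually_0_psi_star: "\<exists>M. \<forall>n\<ge>M. left_act (psi_star (j + int n)) v = 0"
  and eventually_0_psi: "\<exists>M. \<forall>n\<ge>M. left_act (psi (j - int n)) v = 0"
proof -
  obtain N where N: "\<forall>j\<ge>N. left_act (psi_star j) v = 0 \<and> left_act (psi (- j)) v = 0"
    using fock_bounded by blast
  then have "\<forall>n\<ge>nat (N - j). left_act (psi_star (j + int n)) v = 0" by simp
  then show "\<exists>M. \<forall>n\<ge>M. left_act (psi_star (j + int n)) v = 0" by blast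
  have "left_act (psi (j - int n)) v = 0" if "n \<ge> nat (N + j)" for n
    using N[rule_format, of "int n - j"] that by simp
  then show "\<exists>M. \<forall>n\<ge>M. left_act (psi (j - int n)) v = 0" by blast
qed

lemma hamiltonian_psi_star:
  "hamiltonian t (left_act (psi_star j) v) = left_act (psi_star j) (hamiltonian t v)
     + Sum_any (\<lambda>n. fock_scale (fps_log_one_minus t $ n) (left_act (psi_star (j + int n)) v))"
  by (rule hamiltonian_commutator) (simp_all add: eventually_0_psi_star heisenberg_psi_star)

lemma hamiltonian_psi:
  "hamiltonian t (left_act (psi j) v) = left_act (psi j) (hamiltonian t v)
     + Sum_any (\<lambda>n. fock_scale (fps_log_one_minus t $ n) (- left_act (psi (j - int n)) v))"
  by (rule hamiltonian_commutator) (simp_all add: eventually_0_psi heisenberg_psi)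

lemma hamiltonian_vacuum: "hamiltonian t (vacuum :: 'k::field_char_0 fock) = 0"
proof -
  have "fock_scale (fps_log_one_minus t $ n) (heisenberg (int n) vacuum)
      = fock_scale (fps_log_one_minus t $ n) (0 :: 'k fock)" for n
    by (rule log_heisenberg_cong) (simp add: heisenberg_vacuum)
  then show ?thesis unfolding hamiltonian_eq by (simp only: fock.scale_zero_right) simp
qed

interpretation psi_star_shift: log_shift "hamiltonian t" "\<lambda>j. left_act (psi_star j)" t for t
proof (rule log_shift.intro)
  show "\<exists>N. \<forall>j\<ge>N. left_act (psi_star j) v = 0" for v :: "'a fock"
    using fock_bounded by blast
qed (simp_all add: linear_hamiltonian hamiltonian_psi_star)

text \<open>Negating both the index and the Hamiltonian turns the lowering of \<open>psi\<close>
  into the same raising relation as for \<open>psi_star\<close>.\<close>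

interpretation psi_shift: log_shift "\<lambda>v. - hamiltonian t v" "\<lambda>j. left_act (psi (- j))" t for t
proof (rule log_shift.intro)
  show "\<exists>N. \<forall>j\<ge>N. left_act (psi (- j)) v = 0" for v :: "'a fock"
    using fock_bounded by blast
  fix j :: int and v :: "'a fock"
  let ?g = "\<lambda>n. fock_scale (fps_log_one_minus t $ n) (left_act (psi (- (j + int n))) v)"
  obtain M where "\<forall>n\<ge>M. left_act (psi (- j - int n)) v = 0" using eventually_0_psi by blast
  then have "finite {n. ?g n \<noteq> 0}"
    by (intro finite_nonzero_nat[of M]) simp
  then have "- Sum_any ?g = Sum_any (\<lambda>n. - ?g n)"
    by (intro Sum_any_hom) simp_all
  then have "Sum_any (\<lambda>n. - ?g n) = - Sum_any ?g" ..
  then show "- hamiltonian t (left_act (psi (- j)) v) = left_act (psi (- j)) (- hamiltonian t v) + Sum_any ?g"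
    by (simp add: hamiltonian_psi left_act_minus_right)
qed (simp_all add: linear_hamiltonian fock_linear_uminus)

text \<open>The conjugation result passes nilpotency from \<open>v\<close> to a creator applied to
  \<open>v\<close>. For \<open>psi\<close> this goes through the negated Hamiltonian, whose powers
  kill the same vectors.\<close>

lemma hamiltonian_nilpotent: "\<exists>K. (hamiltonian t ^^ K) v = 0"
proof (induction v rule: fock_induct)
  case vacuum
  show ?case by (rule exI[of _ 1]) (simp add: hamiltonian_vacuum)
next
  case (creator x v)
  then obtain K where K: "(hamiltonian t ^^ K) v = 0" by blast
  have minus: "((\<lambda>v. - hamiltonian t v) ^^ k) w = 0 \<longleftrightarrow> (hamiltonian t ^^ k) w = 0" for k w
    by (simp add: funpow_uminus linear_hamiltonian)
  show ?case
  proof (cases x)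
    case (Psi n)
    from K have "((\<lambda>v. - hamiltonian t v) ^^ K) v = 0" by (simp add: minus)
    from psi_shift.exp_op_conjugation(1)[OF this, of "- n"] show ?thesis by (simp add: Psi minus)
  next
    case (Psi_star n)
    with psi_star_shift.exp_op_conjugation(1)[OF K, of n] show ?thesis by simp
  qed
next
  case (add v w)
  then obtain K K' where "(hamiltonian t ^^ K) v = 0" "(hamiltonian t ^^ K') w = 0" by blast
  then have "(hamiltonian t ^^ max K K') v = 0" "(hamiltonian t ^^ max K K') w = 0"
    by (auto intro: funpow_eq_0_mono[OF linear_hamiltonian])
  then have "(hamiltonian t ^^ max K K') (v + w) = 0"
    by (simp add: fock_linear_add[OF fock_linear_funpow[OF linear_hamiltonian]])
  then show ?case by blast
next
  case (scale c v)
  then show ?case by (auto simp: fock_linear_scale[OF fock_linear_funpow[OF linear_hamiltonian]])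
qed

section \<open>Conjugation by the exponentials of the Hamiltonian and its negative\<close>

abbreviation exp_H :: "'k::field_char_0 \<Rightarrow> 'k fock \<Rightarrow> 'k fock" where
  "exp_H t \<equiv> exp_op (hamiltonian t)"

abbreviation exp_minus_H :: "'k::field_char_0 \<Rightarrow> 'k fock \<Rightarrow> 'k fock" where
  "exp_minus_H t \<equiv> exp_op (\<lambda>v. - hamiltonian t v)"

lemma exp_H_psi_star:
  "exp_H t (left_act (psi_star n) v)
     = left_act (psi_star n) (exp_H t v) - fock_scale t (left_act (psi_star (n + 1)) (exp_H t v))"
proof -
  obtain K where "(hamiltonian t ^^ K) v = 0" using hamiltonian_nilpotent by blast
  then show ?thesis by (rule psi_star_shift.exp_op_conjugation(2))
qed

lemma exp_minus_H_psi:
  "exp_minus_H t (left_act (psi n) v)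
     = left_act (psi n) (exp_minus_H t v) - fock_scale t (left_act (psi (n - 1)) (exp_minus_H t v))"
proof -
  obtain K where "(hamiltonian t ^^ K) v = 0" using hamiltonian_nilpotent by blast
  then have "((\<lambda>v. - hamiltonian t v) ^^ K) v = 0" by (simp add: funpow_uminus linear_hamiltonian)
  from psi_shift.exp_op_conjugation(2)[OF this, of "- n"] show ?thesis by simp
qed

lemma exp_minus_H_exp_H: "exp_minus_H t (exp_H t v) = v"
  using hamiltonian_nilpotent[of t v] exp_op_uminus_exp_op[OF linear_hamiltonian] by blast

lemma linear_exp_H: "fock_linear (exp_H t)"
  by (intro linear_exp_op linear_hamiltonian hamiltonian_nilpotent)

lemma linear_exp_minus_H: "fock_linear (exp_minus_H t)"
proof (intro linear_exp_op fock_linear_uminus linear_hamiltonian)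
  fix v
  obtain K where "(hamiltonian t ^^ K) v = 0" using hamiltonian_nilpotent by blast
  then have "((\<lambda>v. - hamiltonian t v) ^^ K) v = 0" by (simp add: funpow_uminus linear_hamiltonian)
  then show "\<exists>K. ((\<lambda>v. - hamiltonian t v) ^^ K) v = 0" ..
qed

text \<open>Descending induction on \<open>n\<close>, starting where \<open>\<psi>\<^sup>*\<^sub>n\<close> kills the vector by local finiteness.\<close>

lemma psi_star_exp_H_eq_0:
  assumes "\<And>n. N \<le> n \<Longrightarrow> left_act (psi_star n) v = 0" and "N \<le> n"
  shows "left_act (psi_star n) (exp_H t v) = 0"
proof -
  obtain M where M: "\<forall>m\<ge>M. left_act (psi_star (n + int m)) (exp_H t v) = 0"
    using eventually_0_psi_star by blast
  have "left_act (psi_star (n + int (M - k))) (exp_H t v) = 0" for k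
  proof (induction k)
    case 0
    show ?case using M by simp
  next
    case (Suc k)
    show ?case
    proof (cases "k < M")
      case True
      let ?n = "n + int (M - Suc k)"
      have "?n + 1 = n + int (M - k)" using True by simp
      then have "left_act (psi_star (?n + 1)) (exp_H t v) = 0" using Suc by simp
      moreover have "left_act (psi_star ?n) v = 0" using assms by simp
      ultimately show ?thesis
        using exp_H_psi_star[of t ?n v] by (simp add: fock_linear_0[OF linear_exp_H])
    next
      case False
      with Suc show ?thesis by simp
    qed
  qed
  from this[of M] show ?thesis by simp
qed

section \<open>Shifted vacua\<close>

text \<open>Used to turn the anticommutation of a generator with itself into the vanishing of its
  square.\<close>

lemma fock_self_minus: "v = - v \<Longrightarrow> v = (0 :: 'k::field_char_0 fock)"
proof -
  assume "v = - v"
  then have "fock_scale 2 v = fock_scale 0 v"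
    using fock.scale_left_distrib[of 1 1 v] by (simp add: eq_neg_iff_add_eq_0)
  then show "v = 0" by (simp only: fock.scale_cancel_right) simp
qed

lemma shifted_vacuum_minus: "shifted_vacuum (- int r) = vacuum_down r"
  by (cases "r = 0") (simp_all add: shifted_vacuum_def)

lemma psi_star_vacuum_down: "- int r \<le> n \<Longrightarrow> left_act (psi_star n) (vacuum_down r :: 'k::field_char_0 fock) = 0"
proof (induction r arbitrary: n)
  case 0
  then show ?case by (simp add: psi_star_vacuum)
next
  case (Suc r)
  show ?case
  proof (cases "n = - int (Suc r)")
    case True
    then show ?thesis
      using fock_self_minus[OF left_act_psi_star_psi_star[of n n "vacuum_down r"]] by simp
  next
    case False
    with Suc.prems have "left_act (psi_star n) (vacuum_down r :: 'k fock) = 0" by (intro Suc.IH) simp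
    then show ?thesis by (simp add: left_act_psi_star_psi_star[of n])
  qed
qed

lemma psi_vacuum_down: "n < - int r \<Longrightarrow> left_act (psi n) (vacuum_down r) = 0"
  by (induction r) (simp_all add: psi_vacuum left_act_psi_psi_star)

lemma psi_vacuum_down_Suc: "left_act (psi (- int (Suc r))) (vacuum_down (Suc r)) = vacuum_down r"
  by (simp add: left_act_psi_psi_star psi_vacuum_down)

text \<open>The terms of positive degree in the commutator with
  \<open>psi_star (- int (Suc r))\<close> have index at least \<open>- r\<close>, and these kill
  \<open>vacuum_down r\<close>.\<close>

lemma hamiltonian_vacuum_down: "hamiltonian t (vacuum_down r :: 'k::field_char_0 fock) = 0"
proof (induction r)
  case 0
  show ?case by (simp add: hamiltonian_vacuum)
next
  case (Suc r)
  have "fock_scale (fps_log_one_minus t $ n)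
      (left_act (psi_star (- int (Suc r) + int n)) (vacuum_down r :: 'k fock)) = 0" for n
    by (cases n) (simp_all add: fps_log_one_minus_def psi_star_vacuum_down)
  with Suc show ?case by (simp only: vacuum_down.simps hamiltonian_psi_star) simp
qed

lemma exp_H_vacuum_down: "exp_H t (vacuum_down r) = vacuum_down r"
  by (rule exp_op_fixed) (simp_all add: hamiltonian_vacuum_down linear_hamiltonian)

lemma transpose_left_act: "transpose_fock (left_act a v) = right_act (transpose_fock v) (clifford_star a)"
proof (induction v rule: fock.abs_induct)
  case (1 b)
  show ?case
    by (simp add: transpose_fock.abs_eq left_act.abs_eq right_act.abs_eq clifford_star_mult)
qed

abbreviation vacuum_bra :: "nat \<Rightarrow> 'k::field_char_0 fock \<Rightarrow> 'k" where
  "vacuum_bra r \<equiv> fock_pairing (dual_shifted_vacuum (- int r))"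

lemma dual_shifted_vacuum_0: "dual_shifted_vacuum (- int 0) = dual_vacuum"
proof -
  have "(1 :: 'a clifford) = clifford_star (scalar 1)"
    by (simp add: scalar.abs_eq clifford_star.abs_eq free_scalar_def zero_fermion_word_def flip: scalar_1)
  then show ?thesis
    by (simp add: dual_shifted_vacuum_def shifted_vacuum_def vacuum.abs_eq transpose_fock.abs_eq
        dual_vacuum.abs_eq scalar_1)
qed

text \<open>Transposition turns the outermost \<open>psi_star\<close> of the ket into the rightmost
  \<open>psi\<close> of the bra, which adjointness moves to the vector.\<close>

lemma vacuum_bra_Suc: "vacuum_bra (Suc r) v = vacuum_bra r (left_act (psi (- int (Suc r))) v)"
  unfolding dual_shifted_vacuum_def shifted_vacuum_minus vacuum_down.simps
  by (simp add: transpose_left_act clifford_star_psi_star fock_pairing_adjoint)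

text \<open>Moved to the left through the bra, \<open>psi n\<close> either meets an equal factor,
  with square 0, or arrives at the dual vacuum with \<open>n \<ge> 0\<close>.\<close>

lemma vacuum_bra_psi: "- int r \<le> n \<Longrightarrow> vacuum_bra r (left_act (psi n) v) = (0 :: 'k::field_char_0)"
proof (induction r arbitrary: n v)
  case 0
  then have "fock_pairing (right_act dual_vacuum (psi n)) v = 0" by (simp add: dual_vacuum_psi)
  then show ?case unfolding dual_shifted_vacuum_0 fock_pairing_adjoint .
next
  case (Suc r)
  show ?case
  proof (cases "n = - int (Suc r)")
    case True
    then show ?thesis
      unfolding vacuum_bra_Suc
      using fock_self_minus[OF left_act_psi_psi[of n n v]] by simp
  next
    case False
    with Suc.prems have "- int r \<le> n" by simp
    with Suc.IH show ?thesis
      unfolding vacuum_bra_Suc left_act_psi_psi[of _ n] by (simp add: fock_pairing_minus)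
  qed
qed

lemma vacuum_bra_vacuum_down: "vacuum_bra r (vacuum_down r) = 1"
proof (induction r)
  case 0
  show ?case unfolding dual_shifted_vacuum_0 by (simp add: fock_pairing_vacuum)
next
  case (Suc r)
  then show ?case unfolding vacuum_bra_Suc psi_vacuum_down_Suc .
qed

section \<open>Partitions\<close>

lemma part_antimono: "is_partition lam \<Longrightarrow> part lam (Suc (Suc i)) \<le> part lam (Suc i)"
  by (auto simp: is_partition_def Defs.part_def sorted_wrt_iff_nth_less)

lemma part_eq_0_iff: "is_partition lam \<Longrightarrow> part lam (Suc i) = 0 \<longleftrightarrow> length lam \<le> i"
  by (auto simp: is_partition_def Defs.part_def Suc_le_eq) (metis gr0I nth_mem)

lemma partition_eqI:
  assumes "is_partition lam" "is_partition mu" and eq: "\<And>i. part lam (Suc i) = part mu (Suc i)"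
  shows "lam = mu"
proof (rule nth_equalityI)
  show len: "length lam = length mu"
    using part_eq_0_iff[OF assms(1)] part_eq_0_iff[OF assms(2)] eq by (metis order_antisym order_refl)
  fix i assume "i < length lam"
  then show "lam ! i = mu ! i" using eq[of i] len by (simp add: Defs.part_def)
qed

section \<open>Duality of the deformed bases\<close>

text \<open>The factors \<open>i + 1, \<dots>, i + d\<close> of the operator chains.\<close>

primrec ket_tail :: "(nat \<Rightarrow> 'k::field_char_0) \<Rightarrow> nat list \<Rightarrow> nat \<Rightarrow> nat \<Rightarrow> 'k fock \<Rightarrow> 'k fock" where
  "ket_tail t lam i 0 v = v"
| "ket_tail t lam i (Suc d) v = left_act (psi (int (part lam (Suc i)) - int (Suc i)))
     (exp_H (t (Suc i)) (ket_tail t lam (Suc i) d v))"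

primrec bra_tail :: "(nat \<Rightarrow> 'k::field_char_0) \<Rightarrow> nat list \<Rightarrow> nat \<Rightarrow> nat \<Rightarrow> 'k fock \<Rightarrow> 'k fock" where
  "bra_tail t mu i 0 v = v"
| "bra_tail t mu i (Suc d) v = bra_tail t mu (Suc i) d
     (exp_minus_H (t (Suc i)) (left_act (psi_star (int (part mu (Suc i)) - int (Suc i))) v))"

text \<open>The chains are defined by adding the last factor, while the duality argument strips the
  first one.\<close>

lemma ket_chain_add: "ket_chain t lam (i + d) v = ket_chain t lam i (ket_tail t lam i d v)"
proof (induction d arbitrary: i)
  case (Suc d)
  from Suc[of "Suc i"] show ?case by simp
qed simp

lemma bra_chain_add: "bra_chain t mu (i + d) v = bra_tail t mu i d (bra_chain t mu i v)"
proof (induction d arbitrary: i)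
  case (Suc d)
  from Suc[of "Suc i"] show ?case by simp
qed simp

lemma linear_bra_tail: "fock_linear (bra_tail t mu i d)"
proof (induction d arbitrary: i)
  case 0
  show ?case by (rule fock_linearI) simp_all
next
  case (Suc d)
  then show ?case
    by (intro fock_linearI)
       (simp_all add: left_act_add_right left_act_scale fock_linear_add[OF linear_exp_minus_H]
         fock_linear_scale[OF linear_exp_minus_H] fock_linear_add[OF Suc] fock_linear_scale[OF Suc])
qed

text \<open>Each factor of a zero part leads from one shifted vacuum to the next: the exponential
  fixes it, and \<open>psi\<close> undoes its outermost \<open>psi_star\<close>.\<close>

lemma ket_tail_empty:
  "length lam \<le> i \<Longrightarrow> ket_tail t lam i d (vacuum_down (i + d)) = vacuum_down i"
proof (induction d arbitrary: i)
  case (Suc d)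
  from Suc.IH[of "Suc i"] Suc.prems have "ket_tail t lam (Suc i) d (vacuum_down (Suc (i + d))) = vacuum_down (Suc i)"
    by simp
  moreover have "part lam (Suc i) = 0" using Suc.prems by (simp add: Defs.part_def)
  ultimately show ?case
    using psi_vacuum_down_Suc[of i] by (simp add: exp_H_vacuum_down del: vacuum_down.simps)
qed simp

lemma deformed_ket_stable:
  assumes "length lam \<le> r"
  shows "deformed_ket t lam (r + d) = deformed_ket t lam r"
  using assms by (simp add: deformed_ket_def shifted_vacuum_minus ket_chain_add ket_tail_empty del: of_nat_add)

text \<open>The leading \<open>psi\<close> has index one below the bound, so
  \<open>psi_star n\<close> passes it without contraction. The bound of the remaining tail is
  smaller because the parts decrease weakly.\<close>

lemma psi_star_ket_tail:
  assumes "is_partition lam" "int (part lam (Suc i)) - int i \<le> n"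
  shows "left_act (psi_star n) (ket_tail t lam i d (vacuum_down (i + d))) = 0"
  using assms(2)
proof (induction d arbitrary: i n)
  case 0
  then show ?case by (simp add: psi_star_vacuum_down)
next
  case (Suc d)
  let ?w = "ket_tail t lam (Suc i) d (vacuum_down (Suc i + d))"
  have "left_act (psi_star m) ?w = 0" if "int (part lam (Suc (Suc i))) - int (Suc i) \<le> m" for m
    using that by (rule Suc.IH)
  moreover have "int (part lam (Suc (Suc i))) - int (Suc i) \<le> n"
    using Suc.prems part_antimono[OF assms(1), of i] by linarith
  ultimately have "left_act (psi_star n) (exp_H (t (Suc i)) ?w) = 0"
    by (rule psi_star_exp_H_eq_0)
  with Suc.prems show ?case
    by (simp add: left_act_psi_star_psi)
qed

lemma bra_tail_psi:
  assumes "is_partition mu" "int (part mu (Suc i)) - int i \<le> n"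
  shows "vacuum_bra (i + d) (bra_tail t mu i d (left_act (psi n) v)) = 0"
  using assms(2)
proof (induction d arbitrary: i n v)
  case 0
  then show ?case by (simp add: vacuum_bra_psi)
next
  case (Suc d)
  let ?b = "\<lambda>v. vacuum_bra (Suc i + d) (bra_tail t mu (Suc i) d v)"
  let ?u = "left_act (psi_star (int (part mu (Suc i)) - int (Suc i))) v"
  \<comment> \<open>Conjugation also produces \<open>psi (n - 1)\<close>; the bound for the next
    tail is lower by at least 1, so this term is still killed.\<close>
  have IH: "?b (left_act (psi m) w) = 0" if "n - 1 \<le> m" for m w
    using that Suc.prems part_antimono[OF assms(1), of i] by (intro Suc.IH) linarith
  have "vacuum_bra (i + Suc d) (bra_tail t mu i (Suc d) (left_act (psi n) v))
      = ?b (exp_minus_H (t (Suc i)) (- left_act (psi n) ?u))"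
    using Suc.prems by (simp add: left_act_psi_star_psi)
  also have "\<dots> = 0"
    by (simp add: fock_linear_minus[OF linear_exp_minus_H] exp_minus_H_psi
        module_hom.diff[OF fock_linear_imp_module_hom[OF linear_bra_tail]]
        fock_linear_scale[OF linear_bra_tail] fock_pairing_diff fock_pairing_scale
        IH[simplified])
  finally show ?case .
qed

text \<open>Compares the leading parts and strips them if they agree. The slack \<open>e\<close>
  lets the ket be longer than the bra, so that \<open>lam\<close> may have more than
  \<open>i + d\<close> parts.\<close>

lemma tail_pairing:
  assumes lam: "is_partition lam" and mu: "is_partition mu"
    and "length mu \<le> i + d" "length lam \<le> i + d + e"
  shows "vacuum_bra (i + d) (bra_tail t mu i d (ket_tail t lam i (d + e) (vacuum_down (i + d + e))))
    = (if \<forall>j\<ge>i. part lam (Suc j) = part mu (Suc j) then 1 else 0)"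
  using assms(3,4)
proof (induction d arbitrary: i)
  case 0
  have mu0: "part mu (Suc j) = 0" if "j \<ge> i" for j
    using 0 that by (simp add: Defs.part_def)
  show ?case
  proof (cases "length lam \<le> i")
    case True
    then have "\<forall>j\<ge>i. part lam (Suc j) = part mu (Suc j)" by (simp add: mu0) (simp add: Defs.part_def)
    with True show ?thesis by (simp add: ket_tail_empty vacuum_bra_vacuum_down)
  next
    case False
    then obtain e' where e: "e = Suc e'" using 0 by (cases e) auto
    \<comment> \<open>The leading \<open>psi\<close> therefore has index at least \<open>- i\<close>
      and is killed by the bra of the vacuum shifted by \<open>- i\<close>.\<close>
    have "part lam (Suc i) > 0" using False part_eq_0_iff[OF lam, of i] by simp
    then show ?thesis using mu0[of i] by (auto simp: e vacuum_bra_psi)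
  qed
next
  case (Suc d)
  let ?a = "part lam (Suc i)" and ?b = "part mu (Suc i)"
  let ?w = "ket_tail t lam (Suc i) (d + e) (vacuum_down (Suc i + (d + e)))"
  let ?k = "ket_tail t lam i (Suc d + e) (vacuum_down (i + (Suc d + e)))"
  have k: "?k = left_act (psi (int ?a - int (Suc i))) (exp_H (t (Suc i)) ?w)" by simp
  consider "?a < ?b" | "?b < ?a" | "?a = ?b" by linarith
  then have "vacuum_bra (i + Suc d) (bra_tail t mu i (Suc d) ?k)
      = (if \<forall>j\<ge>i. part lam (Suc j) = part mu (Suc j) then 1 else 0)"
  proof cases
    case 1
    then have "left_act (psi_star (int ?b - int (Suc i))) ?k = 0"
      by (intro psi_star_ket_tail lam) simp
    then have "bra_tail t mu i (Suc d) ?k = 0"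
      by (simp only: bra_tail.simps fock_linear_0[OF linear_exp_minus_H] fock_linear_0[OF linear_bra_tail])
    with 1 show ?thesis by auto
  next
    case 2
    then have "vacuum_bra (i + Suc d) (bra_tail t mu i (Suc d) ?k) = 0"
      unfolding k by (intro bra_tail_psi mu) simp
    with 2 show ?thesis by auto
  next
    case 3
    \<comment> \<open>This makes the uncontracted term vanish, so that only the contraction 1
      remains.\<close>
    have "left_act (psi_star m) ?w = 0" if "int (part lam (Suc (Suc i))) - int (Suc i) \<le> m" for m
      using that by (intro psi_star_ket_tail lam)
    moreover have "int (part lam (Suc (Suc i))) - int (Suc i) \<le> int ?a - int (Suc i)"
      using part_antimono[OF lam, of i] by linarith
    ultimately have "left_act (psi_star (int ?a - int (Suc i))) (exp_H (t (Suc i)) ?w) = 0"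
      by (rule psi_star_exp_H_eq_0)
    then have "left_act (psi_star (int ?b - int (Suc i))) ?k = exp_H (t (Suc i)) ?w"
      unfolding k 3 by (simp add: left_act_psi_star_psi)
    then have "bra_tail t mu i (Suc d) ?k = bra_tail t mu (Suc i) d ?w"
      by (simp only: bra_tail.simps exp_minus_H_exp_H)
    moreover have "vacuum_bra (Suc i + d) (bra_tail t mu (Suc i) d ?w)
        = (if \<forall>j\<ge>Suc i. part lam (Suc j) = part mu (Suc j) then 1 else 0)"
      using Suc.IH[of "Suc i"] Suc.prems by (simp add: add.assoc)
    moreover have "(\<forall>j\<ge>i. part lam (Suc j) = part mu (Suc j)) \<longleftrightarrow> (\<forall>j\<ge>Suc i. part lam (Suc j) = part mu (Suc j))"
      using 3 by (metis Suc_leI le_neq_implies_less Suc_leD)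
    ultimately show ?thesis by simp
  qed
  then show ?case by (simp only: add.assoc)
qed

theorem theorem3p2:
  fixes t :: "nat \<Rightarrow> 'k::field_char_0"
  shows "(\<forall>lam r s. is_partition lam \<and> length lam \<le> r \<and> length lam \<le> s \<longrightarrow>
            deformed_ket t lam r = deformed_ket t lam s) \<and>
         (\<forall>\<^sub>F r in sequentially. \<forall>lam mu s.
            is_partition lam \<and> is_partition mu \<and> length mu \<le> r \<and> length lam \<le> s \<longrightarrow>
            deformed_bra t mu r (deformed_ket t lam s) = (if lam = mu then 1 else 0))"
proof (intro conjI always_eventually allI impI; elim conjE)
  fix lam :: "nat list" and r s
  assume "length lam \<le> r" "length lam \<le> s"
  then show "deformed_ket t lam r = deformed_ket t lam s"
    using deformed_ket_stable[of lam "length lam" t "r - length lam"]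
      deformed_ket_stable[of lam "length lam" t "s - length lam"] by simp
next
  fix lam mu :: "nat list" and r s
  assume lam: "is_partition lam" and mu: "is_partition mu" and "length mu \<le> r" "length lam \<le> s"
  \<comment> \<open>The ket is padded to \<open>r + s\<close> factors, so that it is at least as
    long as the bra; the slack is then \<open>s\<close>.\<close>
  then have "deformed_bra t mu r (deformed_ket t lam s) = deformed_bra t mu r (deformed_ket t lam (r + s))"
    using deformed_ket_stable[of lam s t r] by (simp add: add.commute)
  also have "\<dots> = vacuum_bra (0 + r) (bra_tail t mu 0 r (ket_tail t lam 0 (r + s) (vacuum_down (0 + r + s))))"
    using ket_chain_add[of t lam 0 "r + s"] bra_chain_add[of t mu 0 r]
    by (simp add: deformed_bra_def deformed_ket_def shifted_vacuum_minus del: of_nat_add)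
  also have "\<dots> = (if \<forall>j\<ge>0. part lam (Suc j) = part mu (Suc j) then 1 else 0)"
    using \<open>length mu \<le> r\<close> \<open>length lam \<le> s\<close> by (intro tail_pairing lam mu) simp_all
  also have "(\<forall>j\<ge>0. part lam (Suc j) = part mu (Suc j)) \<longleftrightarrow> lam = mu"
    using partition_eqI[OF lam mu] by auto
  finally show "deformed_bra t mu r (deformed_ket t lam s) = (if lam = mu then 1 else 0)" .
qed

end
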